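(* Let $d\ge1$ and let $\mu$ be a symmetric nonnegative Radon measure on $\mathbb{R}^d\setminus\{0\}$ with $\int(|z|^2\wedge1)\,\mathrm{d}\mu(z)<+\infty$. Then there is a nonconstant $u\in L^\infty(\mathbb{R}^d)$ such that $\mathcal{L}^\mu[u]=0$ in $\mathcal{D}'(\mathbb{R}^d)$ if and only if $\mathcal{L}^\mu$ is of the form $$\mathcal{L}^\mu[u](x)=\mathrm{P.V.}\int_{z\in V\setminus\{0\}}\big(u(x+z)-u(x)\big)\,\mathrm{d}\mu_0(z)+\sum_{a\in\Lambda\setminus\{0\}}\int_{z\in V+a}\big(u(x+z)-u(x)\big)\,\mathrm{d}\mu_a(z)$$ (for all $u\in L^\infty(\mathbb{R}^d)$, the identity being understood in $\mathcal{D}'(\mathbb{R}^d)$), for some vector subspace $V\subseteq\mathbb{R}^d$, some relative lattice $\Lambda\subseteq\mathbb{R}^d$, and some family $\{\mu_a\}_{a\in\Lambda}$ of Radon measures on $\mathbb{R}^d\setminus\{0\}$ such that: (1) $V\ne\mathbb{R}^d$ and $V\cap\operatorname{Span}_{\mathbb{R}}\Lambda=\{0\}$; (2) $\mu_a\ge0$ and $\mu_a(\cdot)=\mu_{-a}(-\,\cdot)$ for all $a\in\Lambda$; (3) $\operatorname{supp}(\mu_a)\subseteq V+a$ for all $a\in\Lambda$; (4) $\displaystyle\int(|z|^2\wedge1)\,\mathrm{d}\mu_0(z)+\sum_{a\in\Lambda\setminus\{0\}}\mu_a(\mathbb{R}^d)<+\infty$.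
   Context: A nonnegative Radon measure on $\mathbb{R}^d\setminus\{0\}$ is a nonnegative Borel measure on $\mathbb{R}^d\setminus\{0\}$ finite on compact subsets of $\mathbb{R}^d\setminus\{0\}$. It is symmetric if $\mu(B)=\mu(-B)$ for all Borel $B$. The support of such a measure is $\operatorname{supp}(\mu)=\{z\in\mathbb{R}^d\setminus\{0\}:\mu(B_r(z))>0\ \forall r>0\}$, where $B_r(z)$ is the ball of center $z$ and radius $r$. The symbol $\wedge$ denotes the minimum; $\mu_a(\mathbb{R}^d)$ is the total mass of $\mu_a$; $\mu_a(\cdot)=\mu_{-a}(-\,\cdot)$ means $\mu_a(B)=\mu_{-a}(-B)$ for all Borel $B$. The operator $\mathcal{L}^\mu$ is $$\mathcal{L}^\mu[\psi](x)=\mathrm{P.V.}\int_{\mathbb{R}^d\setminus\{0\}}\big(\psi(x+z)-\psi(x)\big)\,\mathrm{d}\mu(z)=\lim_{r\to0^+}\int_{|z|>r}\big(\psi(x+z)-\psi(x)\big)\,\mathrm{d}\mu(z),$$ well defined for $C^2$ functions $\psi$ bounded together with their derivatives up to order two. For $u\in L^\infty(\mathbb{R}^d)$, $\mathcal{L}^\mu[u]$ is understood as the distribution $\psi\mapsto\int_{\mathbb{R}^d}u(x)\,\mathcal{L}^\mu[\psi](x)\,\mathrm{d}x$, $\psi\in C_c^\infty(\mathbb{R}^d)$; "$\mathcal{L}^\mu[u]=0$ in $\mathcal{D}'(\mathbb{R}^d)$" means this distribution is zero. Likewise, for $u\in L^\infty(\mathbb{R}^d)$, the principal-value term with the (symmetric)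 measure $\mu_0$ is understood as the distribution $\psi\mapsto\int_{\mathbb{R}^d}u\,\mathcal{L}^{\mu_0}[\psi]\,\mathrm{d}x$, and the remaining sum over $a\ne0$ as a function in $L^\infty(\mathbb{R}^d)$. "Nonconstant" means not almost everywhere equal to a constant. A relative lattice of $\mathbb{R}^d$ is a subgroup of the form $\bigoplus_{n=1}^m a_n\mathbb{Z}$ with $a_1,\dots,a_m\in\mathbb{R}^d$ linearly independent over $\mathbb{R}$ and $0\le m\le d$ (by convention $\{0\}$ is a relative lattice). Some of the $\mu_a$ may be the zero measure. *)

theory Defs
  imports "HOL-Analysis.Analysis"
begin

primrec Ck :: "nat \<Rightarrow> ('a::euclidean_space \<Rightarrow> real) \<Rightarrow> bool" where
  "Ck 0 f \<longleftrightarrow> continuous_on UNIV f"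
| "Ck (Suc k) f \<longleftrightarrow> (\<forall>x. f differentiable (at x)) \<and>
     (\<forall>b\<in>Basis. Ck k (\<lambda>x. frechet_derivative f (at x) b))"

definition test_function :: "('a::euclidean_space \<Rightarrow> real) \<Rightarrow> bool" where
  "test_function \<psi> \<longleftrightarrow> (\<forall>k. Ck k \<psi>) \<and> compact (closure {x. \<psi> x \<noteq> 0})"

text \<open>Representatives of the classes in \<open>L\<^sup>\<infinity>\<close>. They are taken Borel measurable (every class contains
  such functions), so that \<open>u (x + z)\<close> is measurable in \<open>z\<close> for an arbitrary Borel measure.\<close>

definition L_infty :: "('a::euclidean_space \<Rightarrow> real) \<Rightarrow> bool" where
  "L_infty u \<longleftrightarrow> u \<in> borel_measurable borel \<and> (\<exists>C. AE x in lborel. \<bar>u x\<bar> \<le> C)"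

definition nonconstant :: "('a::euclidean_space \<Rightarrow> real) \<Rightarrow> bool" where
  "nonconstant u \<longleftrightarrow> \<not> (\<exists>c. AE x in lborel. u x = c)"

text \<open>Nonnegative Radon measures on the whole space without the origin: the origin does not belong
  to the underlying space of the measure.\<close>

definition radon_measure :: "'a::euclidean_space measure \<Rightarrow> bool" where
  "radon_measure \<mu> \<longleftrightarrow> sets \<mu> = sets (restrict_space borel (- {0})) \<and>
     (\<forall>K. compact K \<and> K \<subseteq> - {0} \<longrightarrow> emeasure \<mu> K < \<infinity>)"

definition reflected :: "'a::euclidean_space measure \<Rightarrow> 'a measure \<Rightarrow> bool" where
  "reflected \<mu> \<nu> \<longleftrightarrow> (\<forall>B \<in> sets \<mu>. emeasure \<mu> B = emeasure \<nu> (uminus ` B))"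

text \<open>The origin is removed from the ball since \<open>emeasure\<close> vanishes on sets that are not in the
  sigma-algebra.\<close>

definition supp :: "'a::euclidean_space measure \<Rightarrow> 'a set" where
  "supp \<mu> = {z. z \<noteq> 0 \<and> (\<forall>r>0. emeasure \<mu> (ball z r - {0}) > 0)}"

definition levy_mass :: "'a::euclidean_space measure \<Rightarrow> ennreal" where
  "levy_mass \<mu> = (\<integral>\<^sup>+ z. ennreal (min ((norm z)\<^sup>2) 1) \<partial>\<mu>)"

definition levy_op :: "'a::euclidean_space measure \<Rightarrow> ('a \<Rightarrow> real) \<Rightarrow> 'a \<Rightarrow> real" where
  "levy_op \<mu> \<psi> x = Lim (at_right 0) (\<lambda>r. LINT z:{z. norm z > r}|\<mu>. \<psi> (x + z) - \<psi> x)"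

text \<open>\<open>L\<^sup>\<mu>[u]\<close> as a distribution, for \<open>u\<close> in \<open>L\<^sup>\<infinity>\<close> and a symmetric measure \<open>\<mu>\<close>.\<close>

definition levy_dist :: "'a::euclidean_space measure \<Rightarrow> ('a \<Rightarrow> real) \<Rightarrow> ('a \<Rightarrow> real) \<Rightarrow> real" where
  "levy_dist \<mu> u \<psi> = (LINT x|lborel. u x * levy_op \<mu> \<psi> x)"

definition relative_lattice :: "'a::euclidean_space set \<Rightarrow> bool" where
  "relative_lattice \<Lambda> \<longleftrightarrow> (\<exists>B. finite B \<and> independent B \<and>
     \<Lambda> = {\<Sum>b\<in>B. of_int (c b) *\<^sub>R b | c :: 'a \<Rightarrow> int. True})"

text \<open>The function \<open>x \<mapsto> \<Sum>\<^bsub>a \<in> \<Lambda> - {0}\<^esub> \<integral>\<^bsub>V + a\<^esub> (u (x + z) - u x) d\<mu>\<^sub>a(z)\<close>, of use where the series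
  converges absolutely, which is almost everywhere if the total masses are summable.\<close>

definition jump_sum ::
  "'a::euclidean_space set \<Rightarrow> 'a set \<Rightarrow> ('a \<Rightarrow> 'a measure) \<Rightarrow> ('a \<Rightarrow> real) \<Rightarrow> 'a \<Rightarrow> real" where
  "jump_sum V \<Lambda> M u x =
     (\<Sum>\<^sub>\<infinity>a\<in>\<Lambda> - {0}. LINT z:{v + a | v. v \<in> V}|M a. u (x + z) - u x)"

text \<open>The principal-value term is the distribution \<open>levy_dist (M 0) u\<close>; the restriction to
  \<open>V - {0}\<close> is void there because \<open>M 0\<close> is required to be supported in \<open>V\<close>.\<close>

definition has_form ::
  "'a::euclidean_space measure \<Rightarrow> 'a set \<Rightarrow> 'a set \<Rightarrow> ('a \<Rightarrow> 'a measure) \<Rightarrow> bool" where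
  "has_form \<mu> V \<Lambda> M \<longleftrightarrow> (\<forall>u \<psi>. L_infty u \<and> test_function \<psi> \<longrightarrow>
     levy_dist \<mu> u \<psi> = levy_dist (M 0) u \<psi> + (LINT x|lborel. jump_sum V \<Lambda> M u x * \<psi> x))"

end

theory Submission
  imports Defs "HOL-Computational_Algebra.Polynomial"
begin

text \<open>Let \<open>u\<close> be a bounded solution and mollify it to \<open>v\<close>. For \<open>z\<close> in the support of \<open>\<mu>\<close> the function
  \<open>w x = v (x + z) - v x\<close> is again a solution; by the maximum principle, if \<open>w\<close> almost attains a positive
  supremum at \<open>x\<close>, then it almost attains it at \<open>x + z\<close>, \<open>x + 2 z\<close>, ..., so that \<open>v\<close> is unbounded. Hence \<open>v\<close>
  is periodic along the support, and the periods of all mollifications form a closed subgroup, which is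
  proper if \<open>u\<close> is nonconstant. A proper closed subgroup of \<open>\<real>\<^sup>d\<close> is mapped into \<open>\<int>\<close> by some nonzero
  functional \<open>n\<close>, and slicing \<open>\<mu>\<close> along the hyperplanes \<open>n \<bullet> z = k\<close> gives the form claimed, even with
  a lattice of rank one. Conversely, \<open>V\<close> and \<open>\<Lambda>\<close> admit a nonzero \<open>n\<close> that vanishes on \<open>V\<close> and is integral
  on \<open>\<Lambda>\<close>, and \<open>cos (2 \<pi> n \<bullet> x)\<close> is a solution.\<close>

section \<open>Smooth bump functions\<close>

text \<open>The obstacle is that \<open>u\<close> is only bounded and solves the equation only
  against test functions, while a maximum principle needs values at points. Correlating
  \<open>u\<close> with a test function repairs this: translates of test functions are test
  functions, so the correlation satisfies the equation at every point, with bounds uniform in the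
  point. The principal value is removed by symmetry: averaging over \<open>z\<close> and
  \<open>- z\<close> leaves second differences, which are dominated by a multiple of
  \<open>min ((norm z)\<^sup>2) 1\<close> and hence absolutely integrable, so that Fubini and
  dominated convergence apply. A supremum over the whole space need not be attained, which is why
  the maximum principle is phrased with tolerances that do not depend on the point; this replaces a
  passage to limits of translates. In the slicing, the hyperplanes with \<open>k \<noteq> 0\<close>
  stay at a positive distance from the origin. Any infinite mass near the origin therefore lies in
  the slice \<open>k = 0\<close>, and the other slices together have finite mass.\<close>

lemma Ck_SucI:
  assumes "\<And>x. (f has_derivative D x) (at x)" and "\<And>b. b \<in> Basis \<Longrightarrow> Ck k (\<lambda>x. D x b)"
  shows "Ck (Suc k) f"
proof -
  have "frechet_derivative f (at x) = D x" for x
    by (rule frechet_derivative_at[OF assms(1), symmetric])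
  then show ?thesis
    using assms by (auto simp: differentiable_def)
qed

lemma Ck_SucD:
  assumes "Ck (Suc k) f"
  shows "(f has_derivative frechet_derivative f (at x)) (at x)"
    and "b \<in> Basis \<Longrightarrow> Ck k (\<lambda>x. frechet_derivative f (at x) b)"
  using assms frechet_derivative_works by auto

lemma Ck_Suc_imp: "Ck (Suc k) f \<Longrightarrow> Ck k f"
proof (induction k arbitrary: f)
  case 0
  then show ?case
    by (auto intro!: continuous_at_imp_continuous_on differentiable_imp_continuous_within)
qed auto

lemma Ck_imp_continuous_on: "Ck k f \<Longrightarrow> continuous_on UNIV f"
  by (induction k) (use Ck_Suc_imp in auto)

lemma Ck_const: "Ck k (\<lambda>x. c)"
proof (induction k arbitrary: c)
  case (Suc k)
  show ?case
    by (rule Ck_SucI[where D = "\<lambda>x h. 0"]) (use Suc in auto)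
qed auto

lemma Ck_add: "Ck k f \<Longrightarrow> Ck k g \<Longrightarrow> Ck k (\<lambda>x. f x + g x)"
proof (induction k arbitrary: f g)
  case 0
  then show ?case by (auto intro: continuous_intros)
next
  case (Suc k)
  show ?case
    by (rule Ck_SucI[OF has_derivative_add[OF Ck_SucD(1)[OF Suc.prems(1)] Ck_SucD(1)[OF Suc.prems(2)]]])
      (intro Suc.IH Ck_SucD(2)[OF Suc.prems(1)] Ck_SucD(2)[OF Suc.prems(2)])
qed

lemma Ck_mult: "Ck k f \<Longrightarrow> Ck k g \<Longrightarrow> Ck k (\<lambda>x. f x * g x)"
proof (induction k arbitrary: f g)
  case 0
  then show ?case by (auto intro: continuous_intros)
next
  case (Suc k)
  show ?case
    by (rule Ck_SucI[OF has_derivative_mult[OF Ck_SucD(1)[OF Suc.prems(1)] Ck_SucD(1)[OF Suc.prems(2)]]])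
      (intro Ck_add Suc.IH Suc.prems[THEN Ck_Suc_imp] Ck_SucD(2)[OF Suc.prems(1)] Ck_SucD(2)[OF Suc.prems(2)])
qed

lemma Ck_prod: "(\<And>i. i \<in> I \<Longrightarrow> Ck k (f i)) \<Longrightarrow> Ck k (\<lambda>x. \<Prod>i\<in>I. f i x)"
  by (induction I rule: infinite_finite_induct) (auto intro: Ck_const Ck_mult)

lemma Ck_shift: "Ck k f \<Longrightarrow> Ck k (\<lambda>x. f (x + c))"
proof (induction k arbitrary: f)
  case 0
  then show ?case
    by (auto intro!: continuous_on_compose2[of UNIV f] continuous_intros)
next
  case (Suc k)
  show ?case
  proof (rule Ck_SucI)
    show "((\<lambda>x. f (x + c)) has_derivative frechet_derivative f (at (x + c))) (at x)" for x
      by (rule has_derivative_compose[of "\<lambda>x. x + c" "\<lambda>h. h" x UNIV f, simplified])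
        (auto intro!: derivative_eq_intros Ck_SucD(1)[OF Suc.prems])
  qed (intro Suc.IH Ck_SucD(2)[OF Suc.prems])
qed

text \<open>A partial derivative is a constant times the same expression with the next member of the
  sequence \<open>g\<close>, so the induction on \<open>k\<close> has to treat all \<open>n\<close>
  at once.\<close>

lemma Ck_real_compose:
  assumes "\<And>n t. (g n has_real_derivative g (Suc n) t) (at t)"
  shows "Ck k (\<lambda>x. g n (s * (x \<bullet> b) + c))"
proof (induction k arbitrary: n)
  case 0
  have "continuous_on UNIV (g n)"
    using assms by (meson DERIV_continuous_on has_field_derivative_at_within)
  then show ?case
    by (auto intro!: continuous_on_compose2[of UNIV "g n"] continuous_intros)
next
  case (Suc k)
  show ?case
  proof (rule Ck_SucI)
    show "((\<lambda>x. g n (s * (x \<bullet> b) + c)) has_derivative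
        (\<lambda>h. g (Suc n) (s * (x \<bullet> b) + c) * (s * (h \<bullet> b)))) (at x)" for x
      by (rule has_derivative_compose[of "\<lambda>x. s * (x \<bullet> b) + c" "\<lambda>h. s * (h \<bullet> b)" x UNIV "g n"])
        (auto intro!: derivative_eq_intros assms[unfolded has_field_derivative_def, THEN has_derivative_eq_rhs])
  qed (intro Ck_mult Suc Ck_const)
qed

text \<open>With \<open>p = 1\<close> this is the classical smooth function exp(-1/t), extended by
  zero. The polynomial in \<open>1 / t\<close> makes the family closed under
  differentiation.\<close>

definition flat :: "real poly \<Rightarrow> real \<Rightarrow> real" where
  "flat p t = (if t > 0 then poly p (1 / t) * exp (- (1 / t)) else 0)"

lemma tendsto_poly_exp_at_top: "((\<lambda>s. poly p s * exp (- s)) \<longlongrightarrow> (0::real)) at_top"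
proof -
  have "((\<lambda>s. \<Sum>i\<le>degree p. coeff p i * (s ^ i / exp s)) \<longlongrightarrow> (\<Sum>i\<le>degree p. coeff p i * 0)) at_top"
    by (intro tendsto_intros tendsto_power_div_exp_0)
  then show ?thesis
    by (simp add: poly_altdef exp_minus divide_inverse sum_distrib_right mult.assoc)
qed

lemma tendsto_flat_0: "(flat p \<longlongrightarrow> 0) (at_right 0)"
proof -
  have "((\<lambda>t. poly p (inverse t) * exp (- inverse t)) \<longlongrightarrow> 0) (at_right (0::real))"
    by (rule filterlim_compose[OF tendsto_poly_exp_at_top filterlim_inverse_at_top_right])
  then show ?thesis
    by (rule Lim_transform_eventually)
      (auto simp: flat_def eventually_at_filter divide_inverse)
qed

text \<open>With \<open>s = 1 / t\<close>, the derivative of \<open>p(s) exp (- s)\<close> in \<open>t\<close> is \<open>s\<^sup>2 (p(s) - p'(s)) exp (- s)\<close>.\<close>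

definition flat_deriv :: "real poly \<Rightarrow> real poly" where
  "flat_deriv p = [:0, 0, 1:] * (p - pderiv p)"

lemma flat_has_derivative: "(flat p has_real_derivative flat (flat_deriv p) t) (at t)"
proof -
  consider "t > 0" | "t < 0" | "t = 0" by linarith
  then show ?thesis
  proof cases
    case 1
    have "((\<lambda>t. poly p (1 / t) * exp (- (1 / t))) has_real_derivative flat (flat_deriv p) t) (at t)"
      using 1
      by (auto intro!: derivative_eq_intros poly_DERIV[THEN DERIV_chain2]
          simp: flat_def flat_deriv_def field_simps power2_eq_square)
    then show ?thesis
      by (rule has_field_derivative_transform_within_open[of _ _ _ "{0<..}"])
        (use 1 in \<open>auto simp: flat_def\<close>)
  next
    case 2
    have "((\<lambda>t. 0) has_real_derivative flat (flat_deriv p) t) (at t)"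
      using 2 by (auto simp: flat_def)
    then show ?thesis
      by (rule has_field_derivative_transform_within_open[of _ _ _ "{..<0}"])
        (use 2 in \<open>auto simp: flat_def\<close>)
  next
    case 3
    have "((\<lambda>h. (flat p h - flat p 0) / (h - 0)) \<longlongrightarrow> 0) (at 0)"
    proof (rule filterlim_split_at)
      show "((\<lambda>h. (flat p h - flat p 0) / (h - 0)) \<longlongrightarrow> 0) (at_left 0)"
        by (rule tendsto_eventually) (auto simp: flat_def eventually_at_filter)
      \<comment> \<open>Dividing by \<open>h\<close> multiplies the polynomial in
        \<open>1 / h\<close> by its variable, so the difference quotient is again a flat function
        and tends to 0.\<close>
      show "((\<lambda>h. (flat p h - flat p 0) / (h - 0)) \<longlongrightarrow> 0) (at_right 0)"
        by (rule Lim_transform_eventually[OF tendsto_flat_0[of "[:0, 1:] * p"]])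
          (auto simp: flat_def eventually_at_filter)
    qed
    then show ?thesis
      using 3 by (simp add: has_field_derivative_iff flat_def)
  qed
qed

lemma Ck_flat: "Ck k (\<lambda>x. flat 1 (s * (x \<bullet> b) + c))"
  using Ck_real_compose[of "\<lambda>n. flat ((flat_deriv ^^ n) 1)" k 0 s b c] flat_has_derivative by simp

text \<open>The factor \<open>n\<close> steepens the product: for fixed \<open>t > 0\<close>,
  \<open>flat 1 (n * t)\<close> tends to 1, so the bumps approximate the indicator of the open box
  from below. The arguments are written in the shape that \<open>Ck_flat\<close> expects.\<close>

definition bump :: "nat \<Rightarrow> 'a::euclidean_space \<Rightarrow> 'a \<Rightarrow> 'a \<Rightarrow> real" where
  "bump n a b x = (\<Prod>i\<in>Basis. flat 1 (n * (x \<bullet> i) + - (n * (a \<bullet> i))) * flat 1 (- n * (x \<bullet> i) + n * (b \<bullet> i)))"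

lemma flat_1_bounds: "0 \<le> flat 1 t" "flat 1 t \<le> 1"
  by (auto simp: flat_def)

lemma bump_bounds: "0 \<le> bump n a b x" "bump n a b x \<le> 1"
  unfolding bump_def
  by (auto intro!: prod_nonneg prod_le_1 mult_le_one mult_nonneg_nonneg flat_1_bounds)

lemma bump_eq_0:
  assumes "x \<notin> box a b" shows "bump n a b x = 0"
proof -
  obtain i where "i \<in> Basis" "x \<bullet> i \<le> a \<bullet> i \<or> b \<bullet> i \<le> x \<bullet> i"
    using assms by (force simp: mem_box)
  then have "flat 1 (n * (x \<bullet> i) + - (n * (a \<bullet> i))) * flat 1 (- n * (x \<bullet> i) + n * (b \<bullet> i)) = 0"
    using mult_left_mono[of "x \<bullet> i" "a \<bullet> i" "real n"] mult_left_mono[of "b \<bullet> i" "x \<bullet> i" "real n"]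
    by (auto simp: flat_def)
  with \<open>i \<in> Basis\<close> show ?thesis
    unfolding bump_def by (intro prod_zero) auto
qed

lemma test_function_bump: "test_function (bump n a b)"
proof -
  have "closure {x. bump n a b x \<noteq> 0} \<subseteq> cbox a b"
    using bump_eq_0 box_subset_cbox by (intro closure_minimal closed_cbox) blast
  then have "compact (closure {x. bump n a b x \<noteq> 0})"
    by (metis closed_closure bounded_cbox bounded_subset compact_eq_bounded_closed)
  moreover have "Ck k (bump n a b)" for k
    unfolding bump_def[abs_def] by (intro Ck_prod Ck_mult Ck_flat)
  ultimately show ?thesis by (simp add: test_function_def)
qed

lemma bump_tendsto_indicator: "(\<lambda>n. bump n a b x) \<longlonglongrightarrow> indicator (box a b) x"
proof (cases "x \<in> box a b")
  case True
  have lim: "(\<lambda>n. flat 1 (real n * t)) \<longlonglongrightarrow> 1" if "t > 0" for t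
  proof -
    have "(\<lambda>n. exp (- (inverse t * inverse (real n)))) \<longlonglongrightarrow> exp (- (inverse t * 0))"
      by (intro tendsto_intros lim_inverse_n)
    then have "(\<lambda>n. exp (- (inverse t * inverse (real n)))) \<longlonglongrightarrow> 1" by simp
    then show ?thesis
    proof (rule Lim_transform_eventually)
      show "\<forall>\<^sub>F n in sequentially. exp (- (inverse t * inverse (real n))) = flat 1 (real n * t)"
        using eventually_gt_at_top[of "0::nat"]
        by eventually_elim (use that in \<open>auto simp: flat_def field_simps\<close>)
    qed
  qed
  have "(\<lambda>n. \<Prod>i\<in>Basis. flat 1 (real n * (x \<bullet> i - a \<bullet> i)) * flat 1 (real n * (b \<bullet> i - x \<bullet> i)))
      \<longlonglongrightarrow> (\<Prod>i\<in>(Basis::'a set). 1 * 1)"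
    using True by (intro tendsto_intros lim) (auto simp: mem_box)
  then show ?thesis
    using True by (simp add: bump_def[abs_def] algebra_simps)
qed (simp add: bump_eq_0)

section \<open>Test functions and correlations\<close>

lemma test_function_shift:
  assumes "test_function \<psi>"
  shows "test_function (\<lambda>x. \<psi> (x + c))"
proof -
  have eq: "{x. \<psi> (x + c) \<noteq> 0} = (+) (- c) ` {x. \<psi> x \<noteq> 0}"
    by (auto simp: image_iff intro!: exI[of _ "_ + c"])
  have "compact (closure {x. \<psi> (x + c) \<noteq> 0})"
    unfolding eq closure_translation
    by (rule compact_translation) (use assms in \<open>simp add: test_function_def\<close>)
  then show ?thesis
    using assms by (simp add: test_function_def Ck_shift)
qed

lemma test_function_continuous_on: "test_function \<psi> \<Longrightarrow> continuous_on S \<psi>"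
  unfolding test_function_def by (meson Ck_imp_continuous_on continuous_on_subset subset_UNIV)

lemma test_function_measurable [measurable_dest]: "test_function \<psi> \<Longrightarrow> \<psi> \<in> borel_measurable borel"
  by (simp add: borel_measurable_continuous_onI test_function_continuous_on)

lemma test_function_support:
  assumes "test_function \<psi>"
  obtains R where "\<And>x. \<psi> x \<noteq> 0 \<Longrightarrow> x \<in> cball 0 R"
proof -
  have "bounded {x. \<psi> x \<noteq> 0}"
    using assms by (metis bounded_closure_image bounded_subset closure_subset compact_imp_bounded test_function_def)
  then obtain R where "{x. \<psi> x \<noteq> 0} \<subseteq> cball 0 R"
    by (auto simp: bounded_iff subset_iff)
  then show ?thesis using that by blast
qed

lemma test_function_bounded:
  assumes "test_function \<psi>"
  obtains C where "C \<ge> 0" "\<And>x. \<bar>\<psi> x\<bar> \<le> C"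
proof -
  obtain R where R: "\<And>x. \<psi> x \<noteq> 0 \<Longrightarrow> x \<in> cball 0 R"
    using test_function_support[OF assms] by blast
  have "compact (\<psi> ` cball 0 R)"
    by (intro compact_continuous_image test_function_continuous_on assms compact_cball)
  from compact_imp_bounded[OF this]
  obtain C where "\<forall>y\<in>\<psi> ` cball 0 R. norm y \<le> C"
    unfolding bounded_iff by (rule exE)
  then have C: "\<bar>\<psi> x\<bar> \<le> C" if "x \<in> cball 0 R" for x
    using that by (metis imageI real_norm_def)
  have "\<bar>\<psi> x\<bar> \<le> max C 0" for x
    using R[of x] C[of x] by (cases "\<psi> x = 0") auto
  then show ?thesis using that[of "max C 0"] by simp
qed

section \<open>Derivatives and difference bounds of test functions\<close>

lemma test_function_has_derivative:
  "test_function \<psi> \<Longrightarrow> (\<psi> has_derivative frechet_derivative \<psi> (at x)) (at x)"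
  unfolding test_function_def using Ck_SucD(1) by blast

lemma test_function_partial:
  assumes "test_function \<psi>" and "b \<in> Basis"
  shows "test_function (\<lambda>x. frechet_derivative \<psi> (at x) b)"
proof -
  let ?S = "closure {x. \<psi> x \<noteq> 0}"
  have "frechet_derivative \<psi> (at x) b = 0" if "x \<notin> ?S" for x
  proof -
    have "((\<lambda>x. 0) has_derivative frechet_derivative \<psi> (at x)) (at x)"
      by (rule has_derivative_transform_within_open[OF test_function_has_derivative[OF assms(1)], of "- ?S"])
        (use that closure_subset[of "{x. \<psi> x \<noteq> 0}"] in auto)
    then have "frechet_derivative \<psi> (at x) = (\<lambda>h. 0)"
      using has_derivative_const has_derivative_unique by blast
    then show ?thesis by simp
  qed
  then have "closure {x. frechet_derivative \<psi> (at x) b \<noteq> 0} \<subseteq> ?S"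
    by (intro closure_minimal) auto
  moreover have "compact ?S"
    using assms by (simp add: test_function_def)
  ultimately have "compact (closure {x. frechet_derivative \<psi> (at x) b \<noteq> 0})"
    by (meson closed_closure compact_eq_bounded_closed bounded_subset)
  then show ?thesis
    using assms unfolding test_function_def using Ck_SucD(2) by blast
qed

lemma test_function_derivative_expand:
  assumes "test_function \<psi>"
  shows "frechet_derivative \<psi> (at x) h = (\<Sum>b\<in>Basis. (h \<bullet> b) * frechet_derivative \<psi> (at x) b)"
proof -
  interpret bounded_linear "frechet_derivative \<psi> (at x)"
    using test_function_has_derivative[OF assms] has_derivative_bounded_linear by blast
  have "frechet_derivative \<psi> (at x) (\<Sum>b\<in>Basis. (h \<bullet> b) *\<^sub>R b) = (\<Sum>b\<in>Basis. (h \<bullet> b) * frechet_derivative \<psi> (at x) b)"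
    by (simp add: sum scaleR)
  then show ?thesis by (simp add: euclidean_representation)
qed

lemma test_function_lipschitz:
  assumes "test_function \<psi>"
  shows "\<exists>L\<ge>0. \<forall>x y. \<bar>\<psi> x - \<psi> y\<bar> \<le> L * norm (x - y)"
proof -
  have "\<forall>b\<in>Basis. \<exists>C\<ge>0. \<forall>x. \<bar>frechet_derivative \<psi> (at x) b\<bar> \<le> C"
    using test_function_bounded[OF test_function_partial[OF assms]] by metis
  then obtain C where C: "\<And>b x. b \<in> Basis \<Longrightarrow> C b \<ge> 0 \<and> \<bar>frechet_derivative \<psi> (at x) b\<bar> \<le> C b"
    by metis
  let ?L = "\<Sum>b\<in>Basis. C b"
  have "\<bar>frechet_derivative \<psi> (at x) h\<bar> \<le> ?L * norm h" for x h
  proof -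
    have "\<bar>frechet_derivative \<psi> (at x) h\<bar> \<le> (\<Sum>b\<in>Basis. \<bar>(h \<bullet> b) * frechet_derivative \<psi> (at x) b\<bar>)"
      by (subst test_function_derivative_expand[OF assms]) (rule sum_abs)
    also have "\<dots> \<le> (\<Sum>b\<in>Basis. C b * norm h)"
    proof (rule sum_mono)
      fix b :: 'a assume "b \<in> Basis"
      then have "\<bar>frechet_derivative \<psi> (at x) b\<bar> * \<bar>h \<bullet> b\<bar> \<le> C b * norm h"
        using C by (intro mult_mono Basis_le_norm) auto
      then show "\<bar>(h \<bullet> b) * frechet_derivative \<psi> (at x) b\<bar> \<le> C b * norm h"
        by (simp add: abs_mult mult.commute)
    qed
    finally show ?thesis by (simp add: sum_distrib_right)
  qed
  moreover have "?L \<ge> 0" using C by (simp add: sum_nonneg)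
  ultimately have "onorm (frechet_derivative \<psi> (at x)) \<le> ?L" for x
    by (intro onorm_bound) auto
  then have "\<bar>\<psi> x - \<psi> y\<bar> \<le> ?L * norm (x - y)" for x y
    using differentiable_bound[of UNIV \<psi> "\<lambda>x. frechet_derivative \<psi> (at x)" ?L x y]
      test_function_has_derivative[OF assms] by simp
  with \<open>?L \<ge> 0\<close> show ?thesis by blast
qed

text \<open>Twice the average over \<open>z\<close> and \<open>- z\<close> of the increment in the
  operator. First order terms cancel, so no principal value is needed for it.\<close>

definition second_diff :: "('a::real_vector \<Rightarrow> real) \<Rightarrow> 'a \<Rightarrow> 'a \<Rightarrow> real" where
  "second_diff f z x = f (x + z) + f (x - z) - 2 * f x"

text \<open>The mean value theorem along
  \<open>t \<mapsto> \<psi> (x + t z) + \<psi> (x - t z)\<close> leaves a difference of directional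
  derivatives at two points at distance at most \<open>2 * norm z\<close>. The partial derivatives
  are again test functions, hence Lipschitz, which supplies the second power of
  \<open>norm z\<close>.\<close>

lemma second_diff_quadratic:
  assumes "test_function \<psi>"
  obtains C where "C \<ge> 0" "\<And>x z. \<bar>second_diff \<psi> z x\<bar> \<le> C * (norm z)\<^sup>2"
proof -
  let ?D = "\<lambda>x. frechet_derivative \<psi> (at x)"
  have "\<forall>b\<in>Basis. \<exists>L\<ge>0. \<forall>x y. \<bar>?D x b - ?D y b\<bar> \<le> L * norm (x - y)"
    by (intro ballI test_function_lipschitz test_function_partial assms)
  from bchoice[OF this]
  obtain L where "\<forall>b\<in>Basis. 0 \<le> L b \<and> (\<forall>x y. \<bar>?D x b - ?D y b\<bar> \<le> L b * norm (x - y))"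
    by (rule exE)
  then have L: "0 \<le> L b" "\<bar>?D x b - ?D y b\<bar> \<le> L b * norm (x - y)" if "b \<in> Basis" for b x y
    using that by blast+
  let ?L = "\<Sum>b\<in>Basis. L b"
  have D: "\<bar>?D x h - ?D y h\<bar> \<le> ?L * norm h * norm (x - y)" for x y h
  proof -
    have "?D x h - ?D y h = (\<Sum>b\<in>Basis. (h \<bullet> b) * (?D x b - ?D y b))"
      unfolding test_function_derivative_expand[OF assms, of x h] test_function_derivative_expand[OF assms, of y h]
      by (simp add: sum_subtractf right_diff_distrib)
    then have "\<bar>?D x h - ?D y h\<bar> \<le> (\<Sum>b\<in>Basis. \<bar>(h \<bullet> b) * (?D x b - ?D y b)\<bar>)"
      by (simp only: sum_abs)
    also have "\<dots> \<le> (\<Sum>b\<in>Basis. norm h * (L b * norm (x - y)))"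
      unfolding abs_mult by (intro sum_mono mult_mono Basis_le_norm) (use L in auto)
    also have "\<dots> = ?L * norm h * norm (x - y)"
      by (simp add: sum_distrib_right sum_distrib_left mult_ac)
    finally show ?thesis .
  qed
  have L0: "?L \<ge> 0" using L by (simp add: sum_nonneg)
  have "\<bar>second_diff \<psi> z x\<bar> \<le> (2 * ?L) * (norm z)\<^sup>2" for x z
  proof -
    let ?p = "\<lambda>t. \<psi> (x + t *\<^sub>R z) + \<psi> (x - t *\<^sub>R z)"
    have lin: "linear (?D y)" for y
      using test_function_has_derivative[OF assms] has_derivative_linear by blast
    have deriv: "(?p has_real_derivative ?D (x + t *\<^sub>R z) z - ?D (x - t *\<^sub>R z) z) (at t)" for t
    proof -
      have "((\<lambda>t. \<psi> (x + t *\<^sub>R z)) has_derivative (\<lambda>h. ?D (x + t *\<^sub>R z) (h *\<^sub>R z))) (at t)"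
        by (rule has_derivative_compose[of "\<lambda>t. x + t *\<^sub>R z", OF _ test_function_has_derivative[OF assms]])
          (auto intro!: derivative_eq_intros)
      moreover have "((\<lambda>t. \<psi> (x - t *\<^sub>R z)) has_derivative (\<lambda>h. ?D (x - t *\<^sub>R z) (- (h *\<^sub>R z)))) (at t)"
        by (rule has_derivative_compose[of "\<lambda>t. x - t *\<^sub>R z", OF _ test_function_has_derivative[OF assms]])
          (auto intro!: derivative_eq_intros)
      ultimately have "(?p has_derivative (\<lambda>h. ?D (x + t *\<^sub>R z) (h *\<^sub>R z) + ?D (x - t *\<^sub>R z) (- (h *\<^sub>R z)))) (at t)"
        by (rule has_derivative_add)
      then show ?thesis
        unfolding has_field_derivative_def
        by (rule has_derivative_eq_rhs)
          (simp add: fun_eq_iff linear_neg[OF lin] linear_scale[OF lin] left_diff_distrib right_diff_distrib mult.commute)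
    qed
    obtain t where t: "0 < t" "t < 1" "?p 1 - ?p 0 = (1 - 0) * (?D (x + t *\<^sub>R z) z - ?D (x - t *\<^sub>R z) z)"
      using MVT2[of 0 1 ?p "\<lambda>t. ?D (x + t *\<^sub>R z) z - ?D (x - t *\<^sub>R z) z"] deriv by auto
    have "(x + a) - (x - a) = a + a" for a :: 'a
      by (simp add: algebra_simps)
    then have eq: "(x + t *\<^sub>R z) - (x - t *\<^sub>R z) = (2 * t) *\<^sub>R z"
      by (simp only: mult_2 scaleR_add_left)
    have "norm ((2 * t) *\<^sub>R z) = (2 * t) * norm z"
      using t(1) by simp
    also have "\<dots> \<le> 2 * norm z"
      by (rule mult_right_mono) (use t(2) in auto)
    finally have le: "norm ((x + t *\<^sub>R z) - (x - t *\<^sub>R z)) \<le> 2 * norm z"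
      by (simp only: eq)
    have "second_diff \<psi> z x = ?p 1 - ?p 0"
      by (simp add: second_diff_def)
    then have "\<bar>second_diff \<psi> z x\<bar> = \<bar>?D (x + t *\<^sub>R z) z - ?D (x - t *\<^sub>R z) z\<bar>"
      by (simp only: t(3) diff_zero mult_1)
    also have "\<dots> \<le> ?L * norm z * norm ((x + t *\<^sub>R z) - (x - t *\<^sub>R z))"
      by (rule D)
    also have "\<dots> \<le> ?L * norm z * (2 * norm z)"
      by (rule mult_left_mono[OF le]) (use L0 in simp)
    also have "\<dots> = (2 * ?L) * (norm z)\<^sup>2"
      by (simp only: power2_eq_square mult_ac)
    finally show ?thesis .
  qed
  note bound = this
  have "2 * ?L \<ge> 0" using L0 by simp
  then show ?thesis using bound by (rule that)
qed

text \<open>The indicators record where the second difference can be nonzero. Their integrals over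
  \<open>x\<close> do not depend on \<open>z\<close>, which is what makes the bound usable for
  integration over \<open>x\<close> and \<open>z\<close> together.\<close>

lemma second_diff_bound:
  assumes "test_function \<psi>"
  obtains C R where "C \<ge> 0" "\<And>x z. \<bar>second_diff \<psi> z x\<bar> \<le> C * min ((norm z)\<^sup>2) 1 *
    (indicator (cball 0 R) x + indicator (cball 0 R) (x + z) + indicator (cball 0 R) (x - z))"
proof -
  obtain R where R: "\<And>x. \<psi> x \<noteq> 0 \<Longrightarrow> x \<in> cball 0 R"
    using test_function_support[OF assms] by blast
  obtain C1 where C1: "C1 \<ge> 0" "\<And>x z. \<bar>second_diff \<psi> z x\<bar> \<le> C1 * (norm z)\<^sup>2"
    using second_diff_quadratic[OF assms] by blast
  obtain C2 where C2: "C2 \<ge> 0" "\<And>x. \<bar>\<psi> x\<bar> \<le> C2"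
    using test_function_bounded[OF assms] by blast
  \<comment> \<open>\<open>C1\<close> serves for \<open>norm z \<le> 1\<close>; beyond that the four
    values of \<open>\<psi>\<close>, counted with multiplicity, are each at most
    \<open>C2\<close>.\<close>
  let ?C = "C1 + 4 * C2"
  have *: "\<bar>second_diff \<psi> z x\<bar> \<le> ?C * min ((norm z)\<^sup>2) 1" for x z
  proof (cases "(norm z)\<^sup>2 \<le> 1")
    case True
    have "C1 * (norm z)\<^sup>2 \<le> ?C * (norm z)\<^sup>2"
      using C2(1) by (intro mult_right_mono) auto
    then show ?thesis using C1(2)[of z x] True by (simp add: min_def)
  next
    case False
    have "\<bar>second_diff \<psi> z x\<bar> \<le> 4 * C2"
      using C2(2)[of "x + z"] C2(2)[of "x - z"] C2(2)[of x] by (simp add: second_diff_def)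
    then show ?thesis using C1(1) False by (simp add: min_def)
  qed
  have "\<bar>second_diff \<psi> z x\<bar> \<le> ?C * min ((norm z)\<^sup>2) 1 *
    (indicator (cball 0 R) x + indicator (cball 0 R) (x + z) + indicator (cball 0 R) (x - z))" for x z
  proof (cases "x \<in> cball 0 R \<or> x + z \<in> cball 0 R \<or> x - z \<in> cball 0 R")
    case True
    have "?C * min ((norm z)\<^sup>2) 1 * 1 \<le> ?C * min ((norm z)\<^sup>2) 1 *
      (indicator (cball 0 R) x + indicator (cball 0 R) (x + z) + indicator (cball 0 R) (x - z))"
      using C1(1) C2(1) True by (intro mult_left_mono) (auto simp: indicator_def)
    then show ?thesis using *[of z x] by linarith
  next
    case False
    then have "\<psi> x = 0" "\<psi> (x + z) = 0" "\<psi> (x - z) = 0"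
      using R by blast+
    then have "second_diff \<psi> z x = 0"
      by (simp add: second_diff_def)
    then show ?thesis using C1(1) C2(1) by simp
  qed
  then show ?thesis using that[of ?C R] C1(1) C2(1) by simp
qed

lemma second_diff_pointwise_bound:
  assumes "test_function \<psi>"
  obtains C where "C \<ge> 0" "\<And>x z. \<bar>second_diff \<psi> z x\<bar> \<le> C * min ((norm z)\<^sup>2) 1"
proof -
  obtain C R where C: "C \<ge> 0" "\<And>x z. \<bar>second_diff \<psi> z x\<bar> \<le> C * min ((norm z)\<^sup>2) 1 *
    (indicator (cball 0 R) x + indicator (cball 0 R) (x + z) + indicator (cball 0 R) (x - z))"
    using second_diff_bound[OF assms] by blast
  have "\<bar>second_diff \<psi> z x\<bar> \<le> (3 * C) * min ((norm z)\<^sup>2) 1" for x z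
  proof -
    have "C * min ((norm z)\<^sup>2) 1 *
      (indicator (cball 0 R) x + indicator (cball 0 R) (x + z) + indicator (cball 0 R) (x - z))
      \<le> C * min ((norm z)\<^sup>2) 1 * 3"
      using C(1) by (intro mult_left_mono) (auto simp: indicator_def)
    then show ?thesis using C(2)[of z x] by (simp add: mult_ac)
  qed
  then show ?thesis using that[of "3 * C"] C(1) by simp
qed

section \<open>Translations of Lebesgue measure and pairings with bounded functions\<close>

lemma integral_lborel_shift:
  fixes c :: "'a::euclidean_space" and f :: "'a \<Rightarrow> real"
  assumes "f \<in> borel_measurable borel"
  shows "(\<integral>x. f (x + c) \<partial>lborel) = (\<integral>x. f x \<partial>lborel)"
  by (subst (2) lborel_distr_plus[of c, symmetric]) (use assms in \<open>simp add: integral_distr add.commute\<close>)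

lemma integrable_lborel_shift:
  fixes c :: "'a::euclidean_space" and f :: "'a \<Rightarrow> real"
  assumes "integrable lborel f"
  shows "integrable lborel (\<lambda>x. f (x + c))"
proof -
  have "integrable (distr lborel borel ((+) c)) f"
    using assms lborel_distr_plus by metis
  then show ?thesis
    using assms by (simp add: integrable_distr_eq add.commute)
qed

lemma AE_lborel_shift:
  fixes c :: "'a::euclidean_space"
  assumes "AE x in lborel. P x" and [measurable]: "Measurable.pred borel P"
  shows "AE x in lborel. P (x + c)"
proof -
  have "AE x in distr lborel borel ((+) c). P x"
    using assms(1) lborel_distr_plus by metis
  then show ?thesis
    by (subst (asm) AE_distr_iff) (auto simp: add.commute)
qed

lemma L_inftyE:
  assumes "L_infty u"
  obtains C where "C \<ge> 0" "AE x in lborel. \<bar>u x\<bar> \<le> C"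
proof -
  obtain C where "AE x in lborel. \<bar>u x\<bar> \<le> C"
    using assms by (auto simp: L_infty_def)
  then have "AE x in lborel. \<bar>u x\<bar> \<le> max C 0" by eventually_elim auto
  then show ?thesis using that[of "max C 0"] by simp
qed

lemma L_infty_measurable [measurable_dest]: "L_infty u \<Longrightarrow> u \<in> borel_measurable borel"
  by (simp add: L_infty_def)

lemma integrable_indicator_cball [simp]:
  "integrable lborel (\<lambda>x. indicator (cball 0 R) (x::'a::euclidean_space) :: real)"
  by (rule integrable_real_indicator) (use emeasure_lborel_cball_finite[of 0 R] in \<open>auto simp: top.not_eq_extremum\<close>)

lemma has_bochner_integral_indicator_cball_shift:
  fixes c :: "'a::euclidean_space"
  shows "has_bochner_integral lborel (\<lambda>x. indicator (cball 0 R) (x + c) :: real)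
    (\<integral>x. indicator (cball 0 R) (x :: 'a) \<partial>lborel)"
proof -
  have "(\<lambda>x. indicator (cball 0 R) (x :: 'a) :: real) \<in> borel_measurable borel"
    by (intro borel_measurable_indicator borel_closed closed_cball)
  from integral_lborel_shift[OF this, of c] integrable_lborel_shift[OF integrable_indicator_cball, of R c]
  show ?thesis by (simp only: has_bochner_integral_iff simp_thms)
qed

lemma test_function_integrable:
  assumes "test_function \<psi>"
  shows "integrable lborel \<psi>"
proof -
  note [measurable] = assms
  obtain C where C: "C \<ge> 0" "\<And>x. \<bar>\<psi> x\<bar> \<le> C"
    using test_function_bounded[OF assms] by blast
  obtain R where R: "\<And>x. \<psi> x \<noteq> 0 \<Longrightarrow> x \<in> cball 0 R"
    using test_function_support[OF assms] by blast
  have "integrable lborel (\<lambda>x. C * indicator (cball 0 R) (x::'a))"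
    by simp
  then show ?thesis
  proof (rule Bochner_Integration.integrable_bound)
    show "AE x in lborel. norm (\<psi> x) \<le> norm (C * indicator (cball 0 R) x)"
    proof (rule AE_I2)
      fix x show "norm (\<psi> x) \<le> norm (C * indicator (cball 0 R) x)"
        using C R[of x] by (cases "\<psi> x = 0") auto
    qed
  qed simp
qed

lemma L_infty_integrable_mult:
  assumes "L_infty u" and "integrable lborel f"
  shows "integrable lborel (\<lambda>x. u x * f x)"
proof -
  note [measurable] = assms(1)
  obtain C where C: "C \<ge> 0" "AE x in lborel. \<bar>u x\<bar> \<le> C" using L_inftyE[OF assms(1)] by blast
  have "integrable lborel (\<lambda>x. C * \<bar>f x\<bar>)" using assms(2) by simp
  then show ?thesis
  proof (rule Bochner_Integration.integrable_bound)
    show "(\<lambda>x. u x * f x) \<in> borel_measurable lborel" using assms(2) by measurable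
    show "AE x in lborel. norm (u x * f x) \<le> norm (C * \<bar>f x\<bar>)"
      using C(2) by eventually_elim (use C(1) in \<open>auto simp: abs_mult intro: mult_right_mono\<close>)
  qed
qed

lemma L_infty_integral_bound:
  fixes f g :: "'a::euclidean_space \<Rightarrow> real"
  assumes "AE x in lborel. \<bar>u x\<bar> \<le> C" and "C \<ge> 0"
    and "\<And>x. \<bar>f x\<bar> \<le> g x" and "integrable lborel g"
  shows "\<bar>\<integral>x. u x * f x \<partial>lborel\<bar> \<le> C * (\<integral>x. g x \<partial>lborel)"
proof (cases "integrable lborel (\<lambda>x. u x * f x)")
  case True
  have "\<bar>\<integral>x. u x * f x \<partial>lborel\<bar> \<le> (\<integral>x. \<bar>u x * f x\<bar> \<partial>lborel)"
    using integral_abs_bound by blast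
  also have "\<dots> \<le> (\<integral>x. C * g x \<partial>lborel)"
  proof (rule integral_mono_AE)
    show "AE x in lborel. \<bar>u x * f x\<bar> \<le> C * g x"
      using assms(1) by eventually_elim (use assms in \<open>auto simp: abs_mult intro!: mult_mono\<close>)
  qed (use True assms in auto)
  finally show ?thesis by simp
next
  case False
  \<comment> \<open>The integral of a nonintegrable function is 0 by convention, so nonnegativity of
    the right-hand side settles this case.\<close>
  have "g x \<ge> 0" for x using assms(3)[of x] by linarith
  then show ?thesis
    using False assms(2) by (simp add: not_integrable_integral_eq integral_nonneg_AE)
qed

text \<open>The mollification of \<open>u\<close> by the reflected kernel: the distribution
  \<open>u\<close> tested against the translate of \<open>\<psi>\<close> by
  \<open>x\<close>.\<close>

definition correlation :: "('a::euclidean_space \<Rightarrow> real) \<Rightarrow> ('a \<Rightarrow> real) \<Rightarrow> 'a \<Rightarrow> real" where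
  "correlation u \<psi> x = (LINT y|lborel. u y * \<psi> (y - x))"

lemma correlation_integrable:
  assumes "L_infty u" "test_function \<psi>"
  shows "integrable lborel (\<lambda>y. u y * \<psi> (y - x))"
  using L_infty_integrable_mult[OF assms(1) test_function_integrable[OF test_function_shift[OF assms(2), of "- x"]]]
  by simp

text \<open>Second differences are even in \<open>z\<close>, so they pass from the correlation to
  the test function without a change of sign.\<close>

lemma second_diff_correlation:
  assumes "L_infty u" "test_function \<psi>"
  shows "second_diff (correlation u \<psi>) z x = (LINT y|lborel. u y * second_diff \<psi> z (y - x))"
proof -
  have "(LINT y|lborel. u y * second_diff \<psi> z (y - x)) =
    (LINT y|lborel. u y * \<psi> (y - (x - z)) + u y * \<psi> (y - (x + z)) - 2 * (u y * \<psi> (y - x)))"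
    by (intro Bochner_Integration.integral_cong) (auto simp: second_diff_def algebra_simps)
  also have "\<dots> = second_diff (correlation u \<psi>) z x"
    using correlation_integrable[OF assms] by (simp add: second_diff_def correlation_def)
  finally show ?thesis ..
qed

lemma correlation_bounded:
  assumes "L_infty u" "test_function \<psi>"
  obtains K where "\<And>x. \<bar>correlation u \<psi> x\<bar> \<le> K"
proof -
  note [measurable] = assms
  obtain C where C: "C \<ge> 0" "AE x in lborel. \<bar>u x\<bar> \<le> C" using L_inftyE[OF assms(1)] by blast
  have "\<bar>correlation u \<psi> x\<bar> \<le> C * (\<integral>y. \<bar>\<psi> y\<bar> \<partial>lborel)" for x
  proof -
    have "\<bar>correlation u \<psi> x\<bar> \<le> C * (\<integral>y. \<bar>\<psi> (y + - x)\<bar> \<partial>lborel)"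
      unfolding correlation_def
      by (rule L_infty_integral_bound[OF C(2,1)], simp)
        (intro integrable_abs test_function_integrable test_function_shift assms)
    then show ?thesis
      using integral_lborel_shift[of "\<lambda>y. \<bar>\<psi> y\<bar>" "- x"] by simp
  qed
  then show ?thesis using that by blast
qed

text \<open>A Lipschitz bound for \<open>\<psi>\<close> alone is not integrable over the space.
  Restricting it to the two balls that carry the translates of \<open>\<psi>\<close> gives the
  factor \<open>2 * (L * ?I)\<close>.\<close>

lemma correlation_lipschitz:
  assumes "L_infty u" "test_function \<psi>"
  obtains L where "L \<ge> 0" "\<And>x y. \<bar>correlation u \<psi> x - correlation u \<psi> y\<bar> \<le> L * norm (x - y)"
proof -
  note [measurable] = assms
  obtain C where C: "C \<ge> 0" "AE x in lborel. \<bar>u x\<bar> \<le> C" using L_inftyE[OF assms(1)] by blast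
  obtain L where L: "L \<ge> 0" "\<And>x y. \<bar>\<psi> x - \<psi> y\<bar> \<le> L * norm (x - y)"
    using test_function_lipschitz[OF assms(2)] by blast
  obtain R where R: "\<And>x. \<psi> x \<noteq> 0 \<Longrightarrow> x \<in> cball 0 R"
    using test_function_support[OF assms(2)] by blast
  let ?B = "indicator (cball 0 R) :: 'a \<Rightarrow> real"
  let ?I = "\<integral>y. ?B y \<partial>lborel"
  have "\<bar>correlation u \<psi> x - correlation u \<psi> y\<bar> \<le> (C * (2 * (L * ?I))) * norm (x - y)" for x y
  proof -
    have "correlation u \<psi> x - correlation u \<psi> y = (\<integral>t. u t * (\<psi> (t - x) - \<psi> (t - y)) \<partial>lborel)"
      using correlation_integrable[OF assms] by (simp add: correlation_def right_diff_distrib)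
    also have "\<bar>\<dots>\<bar> \<le> C * (\<integral>t. L * norm (x - y) * (?B (t + - x) + ?B (t + - y)) \<partial>lborel)"
    proof (rule L_infty_integral_bound[OF C(2,1)])
      fix t
      have *: "\<bar>\<psi> (t - x) - \<psi> (t - y)\<bar> \<le> L * norm (x - y)"
        using L(2)[of "t - x" "t - y"] by (simp add: norm_minus_commute)
      have **: "0 \<le> L * norm (x - y)" using L(1) by simp
      show "\<bar>\<psi> (t - x) - \<psi> (t - y)\<bar> \<le> L * norm (x - y) * (?B (t + - x) + ?B (t + - y))"
      proof (cases "t - x \<in> cball 0 R \<or> t - y \<in> cball 0 R")
        case True
        have "L * norm (x - y) * 1 \<le> L * norm (x - y) * (?B (t + - x) + ?B (t + - y))"
          using True by (intro mult_left_mono[OF _ **]) (auto simp: indicator_def)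
        then show ?thesis using * by linarith
      next
        case False
        then have "\<psi> (t - x) = 0" "\<psi> (t - y) = 0" using R by blast+
        then show ?thesis using ** by simp
      qed
    next
      show "integrable lborel (\<lambda>t. L * norm (x - y) * (?B (t + - x) + ?B (t + - y)))"
        by (intro integrable_mult_right Bochner_Integration.integrable_add
            integrable_lborel_shift integrable_indicator_cball)
    qed
    also have "(\<integral>t. L * norm (x - y) * (?B (t + - x) + ?B (t + - y)) \<partial>lborel) =
        L * norm (x - y) * (?I + ?I)"
      by (intro has_bochner_integral_integral_eq has_bochner_integral_mult_right
          has_bochner_integral_add has_bochner_integral_indicator_cball_shift)
    finally show ?thesis by (simp add: mult_ac)
  qed
  moreover have "C * (2 * (L * ?I)) \<ge> 0" using C(1) L(1) by simp
  ultimately show ?thesis using that by blast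
qed

text \<open>The constant is uniform in \<open>x\<close>: in the maximum principle this bound
  dominates the integrand at all points simultaneously.\<close>

lemma correlation_second_diff_bound:
  assumes "L_infty u" "test_function \<psi>"
  obtains C where "C \<ge> 0" "\<And>x z. \<bar>second_diff (correlation u \<psi>) z x\<bar> \<le> C * min ((norm z)\<^sup>2) 1"
proof -
  note [measurable] = assms
  obtain K where K: "K \<ge> 0" "AE x in lborel. \<bar>u x\<bar> \<le> K" using L_inftyE[OF assms(1)] by blast
  obtain C R where C: "C \<ge> 0" "\<And>x z. \<bar>second_diff \<psi> z x\<bar> \<le> C * min ((norm z)\<^sup>2) 1 *
    (indicator (cball 0 R) x + indicator (cball 0 R) (x + z) + indicator (cball 0 R) (x - z))"
    using second_diff_bound[OF assms(2)] by blast
  let ?B = "indicator (cball 0 R) :: 'a \<Rightarrow> real"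
  let ?I = "\<integral>y. ?B y \<partial>lborel"
  have "\<bar>second_diff (correlation u \<psi>) z x\<bar> \<le> (K * (C * 3 * ?I)) * min ((norm z)\<^sup>2) 1" for x z
  proof -
    have "\<bar>second_diff (correlation u \<psi>) z x\<bar> \<le> K * (\<integral>t. C * min ((norm z)\<^sup>2) 1 *
        (?B (t + - x) + ?B (t + (z - x)) + ?B (t + (- z - x))) \<partial>lborel)"
      unfolding second_diff_correlation[OF assms]
    proof (rule L_infty_integral_bound[OF K(2,1)])
      show "\<bar>second_diff \<psi> z (t - x)\<bar> \<le> C * min ((norm z)\<^sup>2) 1 *
        (?B (t + - x) + ?B (t + (z - x)) + ?B (t + (- z - x)))" for t
        using C(2)[of z "t - x"] by (simp add: algebra_simps)
      show "integrable lborel (\<lambda>t. C * min ((norm z)\<^sup>2) 1 *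
        (?B (t + - x) + ?B (t + (z - x)) + ?B (t + (- z - x))))"
        by (intro integrable_mult_right Bochner_Integration.integrable_add
            integrable_lborel_shift integrable_indicator_cball)
    qed
    also have "(\<integral>t. C * min ((norm z)\<^sup>2) 1 * (?B (t + - x) + ?B (t + (z - x)) + ?B (t + (- z - x))) \<partial>lborel) =
        C * min ((norm z)\<^sup>2) 1 * (?I + ?I + ?I)"
      by (intro has_bochner_integral_integral_eq has_bochner_integral_mult_right
          has_bochner_integral_add has_bochner_integral_indicator_cball_shift)
    finally show ?thesis by (simp add: mult_ac)
  qed
  moreover have "K * (C * 3 * ?I) \<ge> 0" using K(1) C(1) by simp
  ultimately show ?thesis using that by blast
qed

section \<open>The operator of a symmetric Levy measure\<close>

text \<open>The facts below are used for the given measure, for its slice through the kernel, for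
  the union of its other slices, and for \<open>M 0\<close> in the converse.\<close>

locale levy_measure =
  fixes \<nu> :: "'a::euclidean_space measure"
  assumes sets_eq: "sets \<nu> = sets (restrict_space borel (- {0}))"
    and reflected: "reflected \<nu> \<nu>"
    and levy_mass: "levy_mass \<nu> < \<infinity>"
begin

lemma space_eq: "space \<nu> = - {0}"
  using sets_eq_imp_space_eq[OF sets_eq] by (simp add: space_restrict_space)

lemma borel_imp_sets: "B \<in> sets borel \<Longrightarrow> 0 \<notin> B \<Longrightarrow> B \<in> sets \<nu>"
  by (auto simp: sets_eq sets_restrict_space_iff)

lemma sets_imp_borel: "B \<in> sets \<nu> \<Longrightarrow> B \<in> sets borel"
  by (auto simp: sets_eq sets_restrict_space_iff)

lemma measurable_from_borel: "f \<in> measurable borel N \<Longrightarrow> f \<in> measurable \<nu> N"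
  unfolding measurable_cong_sets[OF sets_eq refl] by (rule measurable_restrict_space1)

lemma measurable_pair_from_borel:
  assumes "f \<in> measurable (borel \<Otimes>\<^sub>M borel) N"
  shows "f \<in> measurable (lborel \<Otimes>\<^sub>M \<nu>) N"
proof -
  have "(\<lambda>p. (fst p, snd p)) \<in> measurable (lborel \<Otimes>\<^sub>M \<nu>) (borel \<Otimes>\<^sub>M borel)"
    by (intro measurable_Pair measurable_fst'' measurable_snd'' measurable_from_borel) auto
  from measurable_compose[OF this assms] show ?thesis by simp
qed

lemma measurable_uminus: "uminus \<in> measurable \<nu> \<nu>"
  unfolding measurable_cong_sets[OF sets_eq sets_eq]
  by (rule measurable_restrict_space3) auto

lemma distr_uminus: "distr \<nu> \<nu> uminus = \<nu>"
proof (rule measure_eqI)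
  fix B assume B: "B \<in> sets (distr \<nu> \<nu> uminus)"
  have "uminus -` B \<inter> space \<nu> = uminus ` B"
  proof -
    have "B \<subseteq> space \<nu>" using B sets.sets_into_space by auto
    then show ?thesis unfolding space_eq by (force simp: image_iff)
  qed
  then show "emeasure (distr \<nu> \<nu> uminus) B = emeasure \<nu> B"
    using B reflected by (simp add: emeasure_distr measurable_uminus reflected_def)
qed simp

lemma integral_uminus:
  fixes f :: "'a \<Rightarrow> real"
  assumes "f \<in> borel_measurable \<nu>"
  shows "(\<integral>z. f (- z) \<partial>\<nu>) = (\<integral>z. f z \<partial>\<nu>)"
  using integral_distr[OF measurable_uminus assms] by (simp add: distr_uminus)

lemma integrable_uminus:
  fixes f :: "'a \<Rightarrow> real"
  assumes "integrable \<nu> f"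
  shows "integrable \<nu> (\<lambda>z. f (- z))"
  using integrable_distr[OF measurable_uminus, of f] assms by (simp add: distr_uminus)

lemma integrable_min: "integrable \<nu> (\<lambda>z. min ((norm z)\<^sup>2) 1)"
proof (rule integrableI_nonneg)
  show "(\<integral>\<^sup>+z. ennreal (min ((norm z)\<^sup>2) 1) \<partial>\<nu>) < \<infinity>"
    using levy_mass by (simp add: levy_mass_def)
  show "(\<lambda>z. min ((norm z)\<^sup>2) 1) \<in> borel_measurable \<nu>"
    by (rule measurable_from_borel) measurable
qed simp

lemma integrable_le_min:
  fixes f :: "'a \<Rightarrow> real"
  assumes "f \<in> borel_measurable borel" and "\<And>z. \<bar>f z\<bar> \<le> C * min ((norm z)\<^sup>2) 1"
  shows "integrable \<nu> f"
proof (rule Bochner_Integration.integrable_bound)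
  show "integrable \<nu> (\<lambda>z. C * min ((norm z)\<^sup>2) 1)" using integrable_min by simp
  show "AE z in \<nu>. norm (f z) \<le> norm (C * min ((norm z)\<^sup>2) 1)"
    using assms(2) by (intro AE_I2) (smt (verit) real_norm_def)
qed (rule measurable_from_borel[OF assms(1)])

lemma integrable_away:
  fixes f :: "'a \<Rightarrow> real"
  assumes [measurable]: "f \<in> borel_measurable borel" and "\<And>z. \<bar>f z\<bar> \<le> C" and "r > 0"
  shows "integrable \<nu> (\<lambda>z. indicator {z. norm z > r} z * f z)"
proof (rule integrable_le_min)
  show "(\<lambda>z. indicator {z. r < norm z} z * f z) \<in> borel_measurable borel" by measurable
next
  fix z :: 'a
  \<comment> \<open>\<open>m\<close> bounds the Levy weight from below on the region
    \<open>norm z > r\<close>, so dividing by it turns the weight into a majorant of 1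
    there.\<close>
  define m where "m = min (r\<^sup>2) 1"
  have "m > 0" using assms(3) by (simp add: m_def)
  have C: "C \<ge> 0" using assms(2)[of z] by linarith
  show "\<bar>indicator {z. r < norm z} z * f z\<bar> \<le> C / m * min ((norm z)\<^sup>2) 1"
  proof (cases "r < norm z")
    case True
    then have "r\<^sup>2 \<le> (norm z)\<^sup>2" using assms(3) by (intro power_mono) auto
    then have "m \<le> min ((norm z)\<^sup>2) 1" by (auto simp: m_def)
    then have "C / m * m \<le> C / m * min ((norm z)\<^sup>2) 1"
      using C \<open>m > 0\<close> by (intro mult_left_mono) auto
    then show ?thesis using assms(2)[of z] \<open>m > 0\<close> True by simp
  next
    case False
    then show ?thesis using C \<open>m > 0\<close> by simp
  qed
qed

lemma emeasure_away_finite: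
  assumes "r > 0"
  shows "emeasure \<nu> {z. norm z > r} < \<infinity>"
proof -
  have "{z. norm z > r} \<inter> space \<nu> = {z. norm z > r}" using assms by (auto simp: space_eq)
  then show ?thesis
    using integrable_away[of "\<lambda>_. 1" 1 r] assms by (simp add: integrable_indicator_iff)
qed

text \<open>Required for Fubini. The mass may be infinite at the origin, so the space is exhausted
  by complements of shrinking balls.\<close>

lemma sigma_finite: "sigma_finite_measure \<nu>"
proof
  let ?A = "range (\<lambda>n::nat. {z::'a. norm z > inverse (real (Suc n))})"
  have "\<Union> ?A = space \<nu>"
  proof -
    have "z \<in> \<Union>?A" if "z \<noteq> 0" for z
    proof -
      have "0 < norm z" using that by simp
      from reals_Archimedean[OF this] obtain n where "inverse (real (Suc n)) < norm z"
        by (rule exE)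
      then show ?thesis by blast
    qed
    moreover have "0 \<notin> \<Union>?A" by (simp add: not_less)
    ultimately show ?thesis unfolding space_eq by blast
  qed
  moreover have "?A \<subseteq> sets \<nu>"
    by (auto intro!: borel_imp_sets)
  moreover have "\<forall>a\<in>?A. emeasure \<nu> a \<noteq> \<infinity>"
  proof
    fix a :: "'a set" assume "a \<in> ?A"
    then obtain n where a: "a = {z. norm z > inverse (real (Suc n))}" by (rule imageE)
    show "emeasure \<nu> a \<noteq> \<infinity>"
      unfolding a using emeasure_away_finite[of "inverse (real (Suc n))"] by simp
  qed
  ultimately show "\<exists>A. countable A \<and> A \<subseteq> sets \<nu> \<and> \<Union> A = space \<nu> \<and> (\<forall>a\<in>A. emeasure \<nu> a \<noteq> \<infinity>)"
    by (intro exI[of _ ?A]) auto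
qed

lemma pair_sigma_finite: "pair_sigma_finite lborel \<nu>"
  by (intro pair_sigma_finite.intro sigma_finite lborel.sigma_finite_measure_axioms)

lemma second_diff_measurable:
  assumes "test_function \<psi>"
  shows "(\<lambda>z. second_diff \<psi> z x) \<in> borel_measurable borel"
    and "(\<lambda>x. second_diff \<psi> z x) \<in> borel_measurable borel"
proof -
  note [measurable] = test_function_measurable[OF assms]
  show "(\<lambda>z. second_diff \<psi> z x) \<in> borel_measurable borel"
    unfolding second_diff_def by measurable
  show "(\<lambda>x. second_diff \<psi> z x) \<in> borel_measurable borel"
    unfolding second_diff_def by measurable
qed

lemma integrable_second_diff:
  assumes "test_function \<psi>"
  shows "integrable \<nu> (\<lambda>z. second_diff \<psi> z x)"
proof -
  obtain C where C: "C \<ge> 0" "\<And>x z. \<bar>second_diff \<psi> z x\<bar> \<le> C * min ((norm z)\<^sup>2) 1"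
    using second_diff_pointwise_bound[OF assms] by metis
  show ?thesis
    by (rule integrable_le_min[OF second_diff_measurable(1)[OF assms] C(2)])
qed

text \<open>Away from the origin the plain increment is integrable, so reflecting \<open>z\<close>
  is legitimate there. The symmetrisation is therefore done before \<open>r\<close> tends to 0, and
  the limit is then taken by dominated convergence.\<close>

lemma truncated_integral_eq:
  assumes "test_function \<psi>" and "r > 0"
  shows "(LINT z:{z. norm z > r}|\<nu>. \<psi> (x + z) - \<psi> x) =
    (\<integral>z. indicator {z. norm z > r} z * second_diff \<psi> z x \<partial>\<nu>) / 2"
proof -
  note [measurable] = test_function_measurable[OF assms(1)]
  obtain C where C: "C \<ge> 0" "\<And>x. \<bar>\<psi> x\<bar> \<le> C"
    using test_function_bounded[OF assms(1)] by metis
  define f where "f z = indicator {z. norm z > r} z * (\<psi> (x + z) - \<psi> x)" for z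
  have f_meas: "f \<in> borel_measurable borel"
    unfolding f_def[abs_def] by measurable
  have int: "integrable \<nu> f"
    unfolding f_def[abs_def]
  proof (rule integrable_away[OF _ _ assms(2)])
    show "\<bar>\<psi> (x + z) - \<psi> x\<bar> \<le> 2 * C" for z
      using C(2)[of "x + z"] C(2)[of x] by linarith
  qed measurable
  have "(\<integral>z. indicator {z. norm z > r} z * second_diff \<psi> z x \<partial>\<nu>) = (\<integral>z. f z + f (- z) \<partial>\<nu>)"
    by (rule Bochner_Integration.integral_cong) (auto simp: f_def second_diff_def indicator_def)
  also have "\<dots> = (\<integral>z. f z \<partial>\<nu>) + (\<integral>z. f (- z) \<partial>\<nu>)"
    by (rule Bochner_Integration.integral_add[OF int integrable_uminus[OF int]])
  also have "\<dots> = 2 * (\<integral>z. f z \<partial>\<nu>)"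
    by (simp add: integral_uminus[OF measurable_from_borel[OF f_meas]])
  finally show ?thesis
    by (simp add: set_lebesgue_integral_def f_def)
qed

lemma levy_op_eq:
  assumes "test_function \<psi>"
  shows "levy_op \<nu> \<psi> x = (\<integral>z. second_diff \<psi> z x \<partial>\<nu>) / 2"
proof -
  note meas [measurable] = second_diff_measurable(1)[OF assms]
  have "((\<lambda>r. \<integral>z. indicator {z. norm z > r} z * second_diff \<psi> z x \<partial>\<nu>) \<longlongrightarrow> (\<integral>z. second_diff \<psi> z x \<partial>\<nu>)) (at_right 0)"
  proof (rule tendsto_at_right_sequentially[OF zero_less_one])
    fix S :: "nat \<Rightarrow> real" assume S: "\<And>n. 0 < S n" "S \<longlonglongrightarrow> 0"
    show "(\<lambda>n. \<integral>z. indicator {z. norm z > S n} z * second_diff \<psi> z x \<partial>\<nu>) \<longlonglongrightarrow> (\<integral>z. second_diff \<psi> z x \<partial>\<nu>)"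
    proof (rule integral_dominated_convergence)
      show "integrable \<nu> (\<lambda>z. \<bar>second_diff \<psi> z x\<bar>)"
        using integrable_second_diff[OF assms] by simp
      show "AE z in \<nu>. (\<lambda>n. indicator {z. norm z > S n} z * second_diff \<psi> z x) \<longlonglongrightarrow> second_diff \<psi> z x"
      proof (rule AE_I2)
        fix z assume "z \<in> space \<nu>"
        then have "0 < norm z" by (simp add: space_eq)
        from order_tendstoD(2)[OF S(2) this]
        have "\<forall>\<^sub>F n in sequentially. indicator {z. norm z > S n} z * second_diff \<psi> z x = second_diff \<psi> z x"
          by eventually_elim simp
        then show "(\<lambda>n. indicator {z. norm z > S n} z * second_diff \<psi> z x) \<longlonglongrightarrow> second_diff \<psi> z x"
          by (rule tendsto_eventually)
      qed
    qed (auto intro!: measurable_from_borel simp: indicator_def)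
  qed
  then have "((\<lambda>r. (\<integral>z. indicator {z. norm z > r} z * second_diff \<psi> z x \<partial>\<nu>) / 2) \<longlongrightarrow> (\<integral>z. second_diff \<psi> z x \<partial>\<nu>) / 2) (at_right 0)"
    by (intro tendsto_divide tendsto_const) auto
  then have "((\<lambda>r. LINT z:{z. norm z > r}|\<nu>. \<psi> (x + z) - \<psi> x) \<longlongrightarrow> (\<integral>z. second_diff \<psi> z x \<partial>\<nu>) / 2) (at_right 0)"
    by (rule Lim_transform_eventually)
      (auto simp: eventually_at_filter truncated_integral_eq[OF assms])
  then show ?thesis
    unfolding levy_op_def by (intro tendsto_Lim) auto
qed

text \<open>Integrating over \<open>x\<close> first replaces the three indicators by three times the
  volume of a ball and leaves a multiple of the Levy weight, which is integrable over
  \<open>z\<close>.\<close>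

lemma integrable_pair_second_diff:
  assumes "L_infty u" "test_function \<psi>"
  shows "integrable (lborel \<Otimes>\<^sub>M \<nu>) (\<lambda>(x, z). u x * second_diff \<psi> z x)"
proof (rule integrableI_bounded)
  interpret P: pair_sigma_finite lborel \<nu> by (rule pair_sigma_finite)
  note [measurable] = L_infty_measurable[OF assms(1)] test_function_measurable[OF assms(2)]
  let ?f = "\<lambda>(x, z). u x * second_diff \<psi> z x"
  show meas: "?f \<in> borel_measurable (lborel \<Otimes>\<^sub>M \<nu>)"
    unfolding second_diff_def by (rule measurable_pair_from_borel) measurable
  obtain K where K: "K \<ge> 0" "AE x in lborel. \<bar>u x\<bar> \<le> K" using L_inftyE[OF assms(1)] by metis
  obtain C R where C: "C \<ge> 0" "\<And>x z. \<bar>second_diff \<psi> z x\<bar> \<le> C * min ((norm z)\<^sup>2) 1 *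
    (indicator (cball 0 R) x + indicator (cball 0 R) (x + z) + indicator (cball 0 R) (x - z))"
    using second_diff_bound[OF assms(2)] by metis
  let ?B = "indicator (cball 0 R) :: 'a \<Rightarrow> real"
  let ?I = "\<integral>y. ?B y \<partial>lborel"
  let ?D = "K * (C * (?I + ?I + ?I))"
  have inner: "(\<integral>\<^sup>+x. ennreal (norm (?f (x, z))) \<partial>lborel) \<le> ennreal (?D * min ((norm z)\<^sup>2) 1)" for z
  proof -
    let ?m = "min ((norm z)\<^sup>2) 1"
    let ?g = "\<lambda>x. K * (C * ?m * (?B (x + 0) + ?B (x + z) + ?B (x + - z)))"
    have g: "has_bochner_integral lborel ?g (K * (C * ?m * (?I + ?I + ?I)))"
      by (intro has_bochner_integral_mult_right has_bochner_integral_add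
          has_bochner_integral_indicator_cball_shift)
    have "(\<integral>\<^sup>+x. ennreal (norm (?f (x, z))) \<partial>lborel) \<le> (\<integral>\<^sup>+x. ennreal (?g x) \<partial>lborel)"
    proof (rule nn_integral_mono_AE)
      show "AE x in lborel. ennreal (norm (?f (x, z))) \<le> ennreal (?g x)"
        using K(2)
      proof eventually_elim
        case (elim x)
        have "\<bar>u x\<bar> * \<bar>second_diff \<psi> z x\<bar> \<le> ?g x"
          using C(2)[of z x] by (intro mult_mono elim K(1)) auto
        then show ?case by (intro ennreal_leI) (simp add: abs_mult)
      qed
    qed
    also have "\<dots> = ennreal (\<integral>x. ?g x \<partial>lborel)"
      using g K(1) C(1) by (intro nn_integral_eq_integral) (auto simp: has_bochner_integral_iff)
    also have "\<dots> = ennreal (?D * ?m)"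
      unfolding has_bochner_integral_integral_eq[OF g] by (simp only: mult_ac)
    finally show ?thesis .
  qed
  have "(\<integral>\<^sup>+p. ennreal (norm (?f p)) \<partial>(lborel \<Otimes>\<^sub>M \<nu>)) = (\<integral>\<^sup>+z. \<integral>\<^sup>+x. ennreal (norm (?f (x, z))) \<partial>lborel \<partial>\<nu>)"
    by (rule P.nn_integral_snd[symmetric]) (use meas in measurable)
  also have "\<dots> \<le> (\<integral>\<^sup>+z. ennreal (?D * min ((norm z)\<^sup>2) 1) \<partial>\<nu>)"
    by (intro nn_integral_mono inner)
  also have "\<dots> = ennreal (\<integral>z. ?D * min ((norm z)\<^sup>2) 1 \<partial>\<nu>)"
    using integrable_min K(1) C(1) by (intro nn_integral_eq_integral) (auto simp: mult_nonneg_nonneg)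
  also have "\<dots> < \<infinity>" by simp
  finally show "(\<integral>\<^sup>+p. ennreal (norm (?f p)) \<partial>(lborel \<Otimes>\<^sub>M \<nu>)) < \<infinity>" .
qed

lemma integrable_inner_second_diff:
  assumes "L_infty u" "test_function \<psi>"
  shows "integrable \<nu> (\<lambda>z. \<integral>x. u x * second_diff \<psi> z x \<partial>lborel)"
proof -
  interpret P: pair_sigma_finite lborel \<nu> by (rule pair_sigma_finite)
  show ?thesis
    by (rule P.integrable_snd[OF integrable_pair_second_diff[OF assms]])
qed

text \<open>The right-hand side is a single absolutely convergent integral over the jumps, so it
  splits along any partition of the measure and vanishes once almost every jump contributes
  zero.\<close>

lemma levy_dist_eq:
  assumes "L_infty u" "test_function \<psi>"
  shows "levy_dist \<nu> u \<psi> = (\<integral>z. \<integral>x. u x * second_diff \<psi> z x \<partial>lborel \<partial>\<nu>) / 2"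
proof -
  interpret P: pair_sigma_finite lborel \<nu> by (rule pair_sigma_finite)
  have "levy_dist \<nu> u \<psi> = (\<integral>x. (\<integral>z. u x * second_diff \<psi> z x \<partial>\<nu>) / 2 \<partial>lborel)"
    using integrable_second_diff[OF assms(2)] by (simp add: levy_dist_def levy_op_eq[OF assms(2)])
  also have "\<dots> = (\<integral>x. \<integral>z. u x * second_diff \<psi> z x \<partial>\<nu> \<partial>lborel) / 2"
    by (rule integral_divide_zero)
  also have "(\<integral>x. \<integral>z. u x * second_diff \<psi> z x \<partial>\<nu> \<partial>lborel) = (\<integral>z. \<integral>x. u x * second_diff \<psi> z x \<partial>lborel \<partial>\<nu>)"
    by (rule P.Fubini_integral[symmetric, OF integrable_pair_second_diff[OF assms]])
  finally show ?thesis .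
qed

text \<open>Every point outside \<open>S\<close> has a null ball around it, and by Lindelof
  countably many of these balls cover the complement of \<open>S\<close>.\<close>

lemma AE_in_closed:
  assumes "closed S" and "supp \<nu> \<subseteq> S"
  shows "AE z in \<nu>. z \<in> S"
proof -
  have "\<forall>z\<in>- S - {0}. \<exists>r>0. emeasure \<nu> (ball z r - {0}) = 0"
    using assms(2) by (auto simp: supp_def subset_iff) (metis not_gr_zero)
  from bchoice[OF this] obtain r where
    "\<forall>z\<in>- S - {0}. 0 < r z \<and> emeasure \<nu> (ball z (r z) - {0}) = 0" by (rule exE)
  then have r: "0 < r z" "emeasure \<nu> (ball z (r z) - {0}) = 0" if "z \<in> - S - {0}" for z
    using that by auto
  let ?F = "(\<lambda>z. ball z (r z)) ` (- S - {0})"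
  obtain F where F: "F \<subseteq> ?F" "countable F" "\<Union>F = \<Union>?F"
    using Lindelof[of ?F] by (metis (no_types, lifting) imageE open_ball)
  have null: "(\<Union>B\<in>F. B - {0}) \<in> null_sets \<nu>"
  proof (rule null_sets_UN'[OF F(2)])
    fix B assume "B \<in> F"
    then obtain z where z: "z \<in> - S - {0}" "B = ball z (r z)" using F(1) by auto
    show "B - {0} \<in> null_sets \<nu>"
      unfolding null_sets_def z(2) using r(2)[OF z(1)] by (auto intro!: borel_imp_sets)
  qed
  show ?thesis
  proof (rule AE_I'[OF null])
    show "{z \<in> space \<nu>. \<not> z \<in> S} \<subseteq> (\<Union>B\<in>F. B - {0})"
    proof
      fix z assume "z \<in> {z \<in> space \<nu>. \<not> z \<in> S}"
      then have z: "z \<in> - S - {0}" by (auto simp: space_eq)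
      then have "z \<in> \<Union>?F" using r(1)[OF z] by (intro UnionI[OF imageI[OF z]]) simp
      then show "z \<in> (\<Union>B\<in>F. B - {0})" using F(3) z by auto
    qed
  qed
qed

end

section \<open>Bounded solutions are periodic along the support\<close>

context levy_measure
begin

text \<open>At a point where \<open>w\<close> almost attains its supremum, the integrand in \<open>L w = 0\<close> is bounded above
  by a function of arbitrarily small integral. A jump landing well below the supremum therefore
  cannot have positive mass.\<close>

lemma almost_max_propagates:
  assumes "\<And>x. w x \<le> M" and "L \<ge> 0" and lip: "\<And>x y. \<bar>w x - w y\<bar> \<le> L * norm (x - y)"
    and "C \<ge> 0" and quad: "\<And>x z. \<bar>second_diff w z x\<bar> \<le> C * min ((norm z)\<^sup>2) 1"
    and harm: "\<And>x. (\<integral>z. second_diff w z x \<partial>\<nu>) = 0"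
    and z0: "z0 \<in> supp \<nu>" and "\<delta> > 0"
  shows "\<exists>\<epsilon>>0. \<forall>x. w x \<ge> M - \<epsilon> \<longrightarrow> w (x + z0) \<ge> M - \<delta>"
proof -
  have "L-lipschitz_on UNIV w"
    using lip assms(2) by (intro lipschitz_onI) (auto simp: dist_norm)
  then have [measurable]: "w \<in> borel_measurable borel"
    by (intro borel_measurable_continuous_onI lipschitz_on_continuous_on)
  have "z0 \<noteq> 0" using z0 by (simp add: supp_def)
  \<comment> \<open>The first bound keeps the ball away from the origin, so that it has finite mass;
    the second makes \<open>w\<close> vary by at most \<open>\<delta> / 2\<close> on the translated
    ball. \<open>L + 1\<close> avoids a division by zero.\<close>
  define r where "r = min (norm z0 / 2) (\<delta> / (2 * (L + 1)))"
  have r: "r > 0" "r \<le> norm z0 / 2" "r \<le> \<delta> / (2 * (L + 1))"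
    using \<open>z0 \<noteq> 0\<close> \<open>\<delta> > 0\<close> \<open>L \<ge> 0\<close> unfolding r_def by (auto simp only: min.cobounded1 min.cobounded2) simp
  let ?B = "ball z0 r"
  have far: "norm z > norm z0 / 2" if "z \<in> ?B" for z
  proof -
    have "norm z0 \<le> norm (z0 - z) + norm z" by (metis diff_add_cancel norm_triangle_ineq)
    moreover have "norm (z0 - z) < r" using that by (simp add: dist_norm)
    ultimately show ?thesis using r(2) by linarith
  qed
  have "0 \<notin> ?B" using far[of 0] \<open>z0 \<noteq> 0\<close> by auto
  then have sets: "?B \<in> sets \<nu>" by (intro borel_imp_sets) auto
  have fin: "emeasure \<nu> ?B < \<infinity>"
  proof -
    have "emeasure \<nu> ?B \<le> emeasure \<nu> {z. norm z > norm z0 / 2}"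
      using far \<open>z0 \<noteq> 0\<close> by (intro emeasure_mono borel_imp_sets) auto
    also have "\<dots> < \<infinity>" using \<open>z0 \<noteq> 0\<close> by (intro emeasure_away_finite) auto
    finally show ?thesis .
  qed
  define m where "m = measure \<nu> ?B"
  have "emeasure \<nu> (?B - {0}) > 0" using z0 r(1) by (simp add: supp_def)
  then have "m > 0"
    using \<open>0 \<notin> ?B\<close> fin unfolding m_def by (simp add: emeasure_eq_ennreal_measure less_top)
  have intB: "integrable \<nu> (indicator ?B :: 'a \<Rightarrow> real)"
    using sets fin by (simp add: integrable_indicator_iff sets.Int_space_eq2)
  have intB_eq: "(\<integral>z. indicator ?B z \<partial>\<nu>) = m"
    using sets by (simp add: m_def sets.Int_space_eq2)
  let ?g = "\<lambda>z::'a. C * min ((norm z)\<^sup>2) 1"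
  have g: "integrable \<nu> ?g" using integrable_min by simp
  \<comment> \<open>With \<open>\<epsilon> = inverse (real (Suc n))\<close>, the integrand bounds
    the second difference at a point where \<open>w\<close> is within \<open>\<epsilon>\<close> of
    \<open>M\<close>: by \<open>2 * \<epsilon>\<close> from the supremum and by \<open>?g\<close>
    from regularity.\<close>
  have lim: "(\<lambda>n. \<integral>z. min (2 * inverse (real (Suc n))) (?g z) \<partial>\<nu>) \<longlonglongrightarrow> (\<integral>z. 0 \<partial>\<nu>)"
  proof (rule integral_dominated_convergence[OF _ _ g])
    show "AE z in \<nu>. (\<lambda>n. min (2 * inverse (real (Suc n))) (?g z)) \<longlonglongrightarrow> 0"
    proof (rule AE_I2)
      fix z :: 'a
      have "(\<lambda>n. min (2 * inverse (real (Suc n))) (?g z)) \<longlonglongrightarrow> min (2 * 0) (?g z)"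
        by (intro tendsto_intros LIMSEQ_inverse_real_of_nat)
      then show "(\<lambda>n. min (2 * inverse (real (Suc n))) (?g z)) \<longlonglongrightarrow> 0"
        using \<open>C \<ge> 0\<close> by (simp add: min_absorb1)
    qed
    show "(\<lambda>z. min (2 * inverse (real (Suc n))) (?g z)) \<in> borel_measurable \<nu>" for n
      by (rule measurable_from_borel) measurable
    show "AE z in \<nu>. norm (min (2 * inverse (real (Suc n))) (?g z)) \<le> ?g z" for n
      using \<open>C \<ge> 0\<close> by (intro AE_I2) (auto simp: abs_if min_def)
  qed simp
  \<comment> \<open>If \<open>w (x + z0)\<close> were below \<open>M - \<delta>\<close>, then on the
    ball the second difference would be at most \<open>2 * \<epsilon> - \<delta> / 2\<close>, hence
    at most \<open>- \<delta> / 4\<close> when \<open>\<epsilon> < \<delta> / 8\<close>. The ball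
    would thus contribute a loss of \<open>\<delta> / 4 * m\<close>, which the remaining integral
    must not be able to compensate.\<close>
  have "\<forall>\<^sub>F n in sequentially. (\<integral>z. min (2 * inverse (real (Suc n))) (?g z) \<partial>\<nu>) < \<delta> / 4 * m"
    using lim \<open>m > 0\<close> \<open>\<delta> > 0\<close> by (intro order_tendstoD(2)[OF lim]) simp
  moreover have "\<forall>\<^sub>F n in sequentially. inverse (real (Suc n)) < \<delta> / 8"
    using \<open>\<delta> > 0\<close> by (intro order_tendstoD(2)[OF LIMSEQ_inverse_real_of_nat]) simp
  ultimately obtain n where n: "(\<integral>z. min (2 * inverse (real (Suc n))) (?g z) \<partial>\<nu>) < \<delta> / 4 * m"
      "inverse (real (Suc n)) < \<delta> / 8"
    using eventually_happens'[OF sequentially_bot eventually_conj] by blast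
  define \<epsilon> where "\<epsilon> = inverse (real (Suc n))"
  have "\<epsilon> > 0" by (simp add: \<epsilon>_def)
  have "w (x + z0) \<ge> M - \<delta>" if x: "w x \<ge> M - \<epsilon>" for x
  proof (rule ccontr)
    assume "\<not> w (x + z0) \<ge> M - \<delta>"
    then have low: "w (x + z0) < M - \<delta>" by simp
    let ?h = "\<lambda>z. min (2 * \<epsilon>) (?g z)"
    have h: "integrable \<nu> ?h"
    proof (rule integrable_le_min)
      show "\<bar>?h z\<bar> \<le> C * min ((norm z)\<^sup>2) 1" for z
        using \<open>C \<ge> 0\<close> \<open>\<epsilon> > 0\<close> by (auto simp: abs_if min_def)
    qed measurable
    have le: "second_diff w z x \<le> ?h z - \<delta> / 4 * indicator ?B z" for z
    proof (cases "z \<in> ?B")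
      case True
      have "L * norm ((x + z) - (x + z0)) \<le> L * r"
        using True \<open>L \<ge> 0\<close> by (intro mult_left_mono) (auto simp: dist_norm norm_minus_commute)
      also have "\<dots> \<le> (L + 1) * r" using r(1) by simp
      also have "\<dots> \<le> \<delta> / 2" using r(3) \<open>L \<ge> 0\<close> by (simp add: field_simps)
      finally have "w (x + z) \<le> w (x + z0) + \<delta> / 2" using lip[of "x + z" "x + z0"] by linarith
      then have "second_diff w z x \<le> - (\<delta> / 4)"
        using low x assms(1)[of "x - z"] n(2) unfolding second_diff_def \<epsilon>_def by linarith
      moreover have "0 \<le> ?h z" using \<open>C \<ge> 0\<close> \<open>\<epsilon> > 0\<close> by simp
      ultimately have "second_diff w z x \<le> ?h z - \<delta> / 4" by linarith
      then show ?thesis using True by simp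
    next
      case False
      have "second_diff w z x \<le> 2 * \<epsilon>"
        using assms(1)[of "x + z"] assms(1)[of "x - z"] x unfolding second_diff_def by linarith
      then show ?thesis using False quad[of z x] by (simp add: abs_le_iff)
    qed
    have "0 = (\<integral>z. second_diff w z x \<partial>\<nu>)" by (simp add: harm)
    also have "\<dots> \<le> (\<integral>z. ?h z - \<delta> / 4 * indicator ?B z \<partial>\<nu>)"
    proof (rule integral_mono)
      show "integrable \<nu> (\<lambda>z. second_diff w z x)"
        by (rule integrable_le_min[OF _ quad]) (unfold second_diff_def, measurable)
      show "integrable \<nu> (\<lambda>z. ?h z - \<delta> / 4 * indicator ?B z)"
        by (intro Bochner_Integration.integrable_diff h integrable_mult_right intB)
    qed (rule le)
    also have "\<dots> = (\<integral>z. ?h z \<partial>\<nu>) - (\<integral>z. \<delta> / 4 * indicator ?B z \<partial>\<nu>)"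
      by (intro Bochner_Integration.integral_diff h integrable_mult_right intB)
    also have "(\<integral>z. \<delta> / 4 * indicator ?B z \<partial>\<nu>) = \<delta> / 4 * m"
      by (simp only: integral_mult_right_zero intB_eq)
    finally show False using n(1) by (simp add: \<epsilon>_def)
  qed
  then show ?thesis using \<open>\<epsilon> > 0\<close> by (intro exI[of _ \<epsilon>]) auto
qed

lemma almost_max_propagates_iterated:
  assumes "\<And>x. w x \<le> M" and "L \<ge> 0" and "\<And>x y. \<bar>w x - w y\<bar> \<le> L * norm (x - y)"
    and "C \<ge> 0" and "\<And>x z. \<bar>second_diff w z x\<bar> \<le> C * min ((norm z)\<^sup>2) 1"
    and "\<And>x. (\<integral>z. second_diff w z x \<partial>\<nu>) = 0"
    and "z0 \<in> supp \<nu>" and "\<delta> > 0"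
  shows "\<exists>\<epsilon>>0. \<forall>x. w x \<ge> M - \<epsilon> \<longrightarrow> (\<forall>k\<le>N. w (x + real k *\<^sub>R z0) \<ge> M - \<delta>)"
  using \<open>\<delta> > 0\<close>
proof (induction N arbitrary: \<delta>)
  case 0
  then show ?case by (intro exI[of _ \<delta>]) auto
next
  case (Suc N)
  obtain \<epsilon>1 where e1: "\<epsilon>1 > 0" "\<And>x. w x \<ge> M - \<epsilon>1 \<Longrightarrow> w (x + z0) \<ge> M - \<delta>"
    using almost_max_propagates[OF assms(1-7) Suc.prems] by blast
  \<comment> \<open>Tolerance \<open>\<delta>\<close> is wanted at the first \<open>N\<close> steps,
    and tolerance \<open>\<epsilon>1\<close> at the last of them allows one further step.\<close>
  have "min \<delta> \<epsilon>1 > 0" using e1(1) Suc.prems by simp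
  from Suc.IH[OF this] obtain \<epsilon> where e: "\<epsilon> > 0"
      "\<And>x k. w x \<ge> M - \<epsilon> \<Longrightarrow> k \<le> N \<Longrightarrow> w (x + real k *\<^sub>R z0) \<ge> M - min \<delta> \<epsilon>1"
    by blast
  have "w (x + real k *\<^sub>R z0) \<ge> M - \<delta>" if x: "w x \<ge> M - \<epsilon>" and k: "k \<le> Suc N" for x k
  proof (cases "k \<le> N")
    case True
    then show ?thesis using e(2)[OF x True] by linarith
  next
    case False
    then have "k = Suc N" using k by simp
    then have eq: "x + real k *\<^sub>R z0 = (x + real N *\<^sub>R z0) + z0" by (simp add: algebra_simps)
    have "w (x + real N *\<^sub>R z0) \<ge> M - \<epsilon>1" using e(2)[OF x order_refl] by linarith
    then show ?thesis unfolding eq by (rule e1(2))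
  qed
  then show ?case using e(1) by (intro exI[of _ \<epsilon>]) auto
qed

lemma bounded_harmonic_le:
  assumes bdd: "\<And>x. \<bar>v x\<bar> \<le> K" and "L \<ge> 0" and lip: "\<And>x y. \<bar>v x - v y\<bar> \<le> L * norm (x - y)"
    and "C \<ge> 0" and quad: "\<And>x z. \<bar>second_diff v z x\<bar> \<le> C * min ((norm z)\<^sup>2) 1"
    and harm: "\<And>x. (\<integral>z. second_diff v z x \<partial>\<nu>) = 0"
    and z0: "z0 \<in> supp \<nu>"
  shows "v (x + z0) \<le> v x"
proof (rule ccontr)
  assume x: "\<not> v (x + z0) \<le> v x"
  define w where "w y = v (y + z0) - v y" for y
  define M where "M = Sup (range w)"
  have "w y \<le> 2 * K" for y
    using bdd[of "y + z0"] bdd[of y] unfolding w_def by linarith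
  then have bdd_w: "bdd_above (range w)" by (intro bdd_aboveI[of _ "2 * K"]) auto
  have wM: "w y \<le> M" for y
    unfolding M_def by (intro cSup_upper bdd_w) simp
  have "M > 0" using wM[of x] x by (simp add: w_def)
  have "L-lipschitz_on UNIV v"
    using lip assms(2) by (intro lipschitz_onI) (auto simp: dist_norm)
  then have [measurable]: "v \<in> borel_measurable borel"
    by (intro borel_measurable_continuous_onI lipschitz_on_continuous_on)
  have sd: "second_diff w z y = second_diff v z (y + z0) - second_diff v z y" for z y
    by (simp add: second_diff_def w_def algebra_simps)
  have int: "integrable \<nu> (\<lambda>z. second_diff v z y)" for y
    by (rule integrable_le_min[OF _ quad]) (unfold second_diff_def, measurable)
  have harm_w: "(\<integral>z. second_diff w z y \<partial>\<nu>) = 0" for y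
    unfolding sd by (simp add: int harm)
  have lip_w: "\<bar>w a - w b\<bar> \<le> (2 * L) * norm (a - b)" for a b
    using lip[of "a + z0" "b + z0"] lip[of a b] unfolding w_def by simp
  have quad_w: "\<bar>second_diff w z y\<bar> \<le> (2 * C) * min ((norm z)\<^sup>2) 1" for z y
    using quad[of z "y + z0"] quad[of z y] unfolding sd by linarith
  \<comment> \<open>Each of \<open>N\<close> steps will gain at least \<open>M / 2\<close>, while
    \<open>v\<close> oscillates by at most \<open>2 * K\<close>.\<close>
  obtain N :: nat where N: "4 * K < real N * M"
    using reals_Archimedean3[OF \<open>M > 0\<close>] by blast
  have "\<exists>\<epsilon>>0. \<forall>x. w x \<ge> M - \<epsilon> \<longrightarrow> (\<forall>k\<le>N. w (x + real k *\<^sub>R z0) \<ge> M - M / 2)"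
    by (rule almost_max_propagates_iterated[OF wM _ lip_w _ quad_w harm_w z0])
      (use \<open>L \<ge> 0\<close> \<open>C \<ge> 0\<close> \<open>M > 0\<close> in auto)
  then obtain \<epsilon> where e: "\<epsilon> > 0"
      "\<And>x k. w x \<ge> M - \<epsilon> \<Longrightarrow> k \<le> N \<Longrightarrow> w (x + real k *\<^sub>R z0) \<ge> M - M / 2"
    by blast
  have "M - \<epsilon> < Sup (range w)" using e(1) by (simp add: M_def)
  then obtain s where s: "s \<in> range w" "M - \<epsilon> < s"
    by (rule less_cSupE) auto
  obtain y where "s = w y" using s(1) by (rule rangeE)
  then have y: "w y \<ge> M - \<epsilon>" using s(2) by simp
  have tele: "(\<Sum>k<n. w (y + real k *\<^sub>R z0)) = v (y + real n *\<^sub>R z0) - v y" for n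
    by (induction n) (auto simp: w_def algebra_simps)
  have "real N * (M / 2) = (\<Sum>k<N. M / 2)" by simp
  also have "\<dots> \<le> (\<Sum>k<N. w (y + real k *\<^sub>R z0))"
    using e(2)[OF y] by (intro sum_mono) (force dest: less_imp_le)
  also have "\<dots> \<le> 2 * K"
    unfolding tele using bdd[of "y + real N *\<^sub>R z0"] bdd[of y] by linarith
  finally show False using N by simp
qed

text \<open>All hypotheses are invariant under a change of sign of \<open>v\<close>, so the
  one-sided inequality applies to \<open>v\<close> and to \<open>- v\<close>.\<close>

lemma bounded_harmonic_periodic:
  assumes bdd: "\<And>x. \<bar>v x\<bar> \<le> K" and "L \<ge> 0" and lip: "\<And>x y. \<bar>v x - v y\<bar> \<le> L * norm (x - y)"
    and "C \<ge> 0" and quad: "\<And>x z. \<bar>second_diff v z x\<bar> \<le> C * min ((norm z)\<^sup>2) 1"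
    and harm: "\<And>x. (\<integral>z. second_diff v z x \<partial>\<nu>) = 0"
    and z0: "z0 \<in> supp \<nu>"
  shows "v (x + z0) = v x"
proof (rule antisym)
  show "v (x + z0) \<le> v x" by (rule bounded_harmonic_le[OF assms])
  have sd: "second_diff (\<lambda>x. - v x) z x = - second_diff v z x" for z x
    by (simp add: second_diff_def)
  have "- v (x + z0) \<le> - v x"
  proof (rule bounded_harmonic_le[OF _ assms(2) _ assms(4) _ _ z0])
    show "\<bar>- v x\<bar> \<le> K" for x using bdd[of x] by simp
    show "\<bar>- v x - - v y\<bar> \<le> L * norm (x - y)" for x y using lip[of x y] by simp
    show "\<bar>second_diff (\<lambda>x. - v x) z x\<bar> \<le> C * min ((norm z)\<^sup>2) 1" for x z
      using quad[of z x] by (simp add: sd)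
    show "(\<integral>z. second_diff (\<lambda>x. - v x) z x \<partial>\<nu>) = 0" for x
      using harm[of x] by (simp add: sd)
  qed
  then show "v x \<le> v (x + z0)" by simp
qed

lemma correlation_periodic:
  assumes u: "L_infty u" and "\<And>\<psi>. test_function \<psi> \<Longrightarrow> levy_dist \<nu> u \<psi> = 0"
    and \<psi>: "test_function \<psi>" and z0: "z0 \<in> supp \<nu>"
  shows "correlation u \<psi> (x + z0) = correlation u \<psi> x"
proof -
  obtain K where K: "\<And>x. \<bar>correlation u \<psi> x\<bar> \<le> K"
    using correlation_bounded[OF u \<psi>] by metis
  obtain L where L: "L \<ge> 0" "\<And>x y. \<bar>correlation u \<psi> x - correlation u \<psi> y\<bar> \<le> L * norm (x - y)"
    using correlation_lipschitz[OF u \<psi>] by metis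
  obtain C where C: "C \<ge> 0" "\<And>x z. \<bar>second_diff (correlation u \<psi>) z x\<bar> \<le> C * min ((norm z)\<^sup>2) 1"
    using correlation_second_diff_bound[OF u \<psi>] by metis
  have "(\<integral>z. second_diff (correlation u \<psi>) z x \<partial>\<nu>) = 0" for x
  proof -
    \<comment> \<open>Testing the equation with the translated function evaluates it at the point
      \<open>x\<close>; the factor 2 below undoes the symmetrisation.\<close>
    let ?\<phi> = "\<lambda>y. \<psi> (y + - x)"
    have \<phi>: "test_function ?\<phi>" by (rule test_function_shift[OF \<psi>])
    have "second_diff ?\<phi> z y = second_diff \<psi> z (y - x)" for z y
      by (simp add: second_diff_def algebra_simps)
    then have "(\<integral>z. second_diff (correlation u \<psi>) z x \<partial>\<nu>) = 2 * levy_dist \<nu> u ?\<phi>"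
      unfolding levy_dist_eq[OF u \<phi>] second_diff_correlation[OF u \<psi>] by simp
    then show ?thesis by (simp only: assms(2)[OF \<phi>] mult_zero_right)
  qed
  then show ?thesis
    by (rule bounded_harmonic_periodic[OF K L C _ z0])
qed

end

section \<open>Recovering a function from its correlations\<close>

text \<open>After a translation the shift sits on \<open>u\<close>, and the bumps converge on a
  fixed box, dominated by its indicator.\<close>

lemma correlation_tendsto_box_integral:
  assumes "L_infty u"
  shows "(\<lambda>n. correlation u (bump n a b) x) \<longlonglongrightarrow> (LINT y|lborel. u (y + x) * indicator (box a b) y)"
proof -
  note [measurable] = L_infty_measurable[OF assms] test_function_measurable[OF test_function_bump]
  obtain C where C: "C \<ge> 0" "AE y in lborel. \<bar>u y\<bar> \<le> C" using L_inftyE[OF assms] by metis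
  have ux: "AE y in lborel. \<bar>u (y + x)\<bar> \<le> C"
    by (rule AE_lborel_shift[OF C(2)]) measurable
  have eq: "correlation u (bump n a b) x = (LINT y|lborel. u (y + x) * bump n a b y)" for n
    using integral_lborel_shift[of "\<lambda>y. u y * bump n a b (y - x)" x] by (simp add: correlation_def)
  show ?thesis
    unfolding eq
  proof (rule integral_dominated_convergence)
    show "integrable lborel (\<lambda>y. C * indicator (box a b) (y :: 'a) :: real)"
      by (intro integrable_mult_right integrable_real_indicator)
        (auto simp: emeasure_lborel_box_eq)
    show "AE y in lborel. (\<lambda>n. u (y + x) * bump n a b y) \<longlonglongrightarrow> u (y + x) * indicator (box a b) y"
      by (intro AE_I2 tendsto_mult_left bump_tendsto_indicator)
    show "AE y in lborel. norm (u (y + x) * bump n a b y) \<le> C * indicator (box a b) y" for n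
      using ux
    proof eventually_elim
      case (elim y)
      show ?case
      proof (cases "y \<in> box a b")
        case True
        have "\<bar>u (y + x)\<bar> * bump n a b y \<le> C * 1"
          using elim C(1) by (intro mult_mono bump_bounds) auto
        then show ?thesis using True bump_bounds(1)[of n a b y] by (simp add: abs_mult)
      qed (simp add: bump_eq_0)
    qed
  qed measurable
qed

text \<open>After adding a constant \<open>u\<close> becomes the density of a measure, and measures that are finite and
  equal on boxes coincide.\<close>

lemma AE_shift_eq_if_correlation_eq:
  assumes u: "L_infty u" and eq: "\<And>\<psi>. test_function \<psi> \<Longrightarrow> correlation u \<psi> x = correlation u \<psi> 0"
  shows "AE y in lborel. u (y + x) = u y"
proof -
  note [measurable] = L_infty_measurable[OF u]
  obtain C where C: "C \<ge> 0" "AE y in lborel. \<bar>u y\<bar> \<le> C" using L_inftyE[OF u] by metis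
  have ux: "AE y in lborel. \<bar>u (y + c)\<bar> \<le> C" for c
    by (rule AE_lborel_shift[OF C(2)]) measurable
  define I where "I c a b = (LINT y|lborel. u (y + c) * indicator (box a b) y)" for c a b :: 'a
  have I_eq: "I x a b = I 0 a b" for a b
    using LIMSEQ_unique[OF correlation_tendsto_box_integral[OF u, of a b x]
        correlation_tendsto_box_integral[OF u, of a b 0, folded eq[OF test_function_bump]]]
    by (simp add: I_def)
  \<comment> \<open>\<open>C\<close> bounds every translate of \<open>u\<close> almost everywhere,
    so the truncation of negative values by \<open>ennreal\<close> only affects a null set.\<close>
  define p where "p c y = ennreal (u (y + c) + C)" for c y
  have p_meas [measurable]: "p c \<in> borel_measurable borel" for c
    unfolding p_def[abs_def] by measurable
  have ind: "integrable lborel (indicator (box a b) :: 'a \<Rightarrow> real)" for a b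
    by (rule integrable_real_indicator) (auto simp: emeasure_lborel_box_eq)
  have box: "emeasure (density lborel (p c)) (box a b) = ennreal (I c a b + C * measure lborel (box a b))" for c a b
  proof -
    have int: "integrable lborel (\<lambda>y. u (y + c) * indicator (box a b) y)"
    proof (rule Bochner_Integration.integrable_bound)
      show "integrable lborel (\<lambda>y. C * indicator (box a b) y :: real)"
        using ind by simp
      show "AE y in lborel. norm (u (y + c) * indicator (box a b) y) \<le> norm (C * indicator (box a b) y :: real)"
        using ux[of c] by eventually_elim (use C(1) in \<open>auto simp: indicator_def\<close>)
    qed measurable
    have "emeasure (density lborel (p c)) (box a b) = (\<integral>\<^sup>+y. p c y * indicator (box a b) y \<partial>lborel)"
      by (rule emeasure_density) auto
    also have "\<dots> = (\<integral>\<^sup>+y. ennreal (u (y + c) * indicator (box a b) y + C * indicator (box a b) y) \<partial>lborel)"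
      by (intro nn_integral_cong) (auto simp: p_def indicator_def)
    also have "\<dots> = ennreal (\<integral>y. u (y + c) * indicator (box a b) y + C * indicator (box a b) y \<partial>lborel)"
    proof (rule nn_integral_eq_integral)
      show "integrable lborel (\<lambda>y. u (y + c) * indicator (box a b) y + C * indicator (box a b) y)"
        using int ind by simp
      show "AE y in lborel. 0 \<le> u (y + c) * indicator (box a b) y + C * indicator (box a b) y"
        using ux[of c] by eventually_elim (auto simp: indicator_def)
    qed
    also have "(\<integral>y. u (y + c) * indicator (box a b) y + C * indicator (box a b) y \<partial>lborel) =
        I c a b + C * measure lborel (box a b)"
      using int ind by (simp add: I_def)
    finally show ?thesis .
  qed
  have "density lborel (p x) = density lborel (p 0)"
  proof (rule measure_eqI_generator_eq)
    let ?E = "range (\<lambda>(a, b). box a b::'a set)"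
    show "Int_stable ?E"
      by (auto simp: Int_stable_def box_Int_box)
    show "?E \<subseteq> Pow UNIV" "sets (density lborel (p x)) = sigma_sets UNIV ?E"
      "sets (density lborel (p 0)) = sigma_sets UNIV ?E"
      by (simp_all add: borel_eq_box)
    let ?A = "\<lambda>n::nat. box (- (real n *\<^sub>R One)) (real n *\<^sub>R One) :: 'a set"
    show "range ?A \<subseteq> ?E" "(\<Union>i. ?A i) = UNIV"
      unfolding UN_box_eq_UNIV by auto
    show "emeasure (density lborel (p x)) (?A i) \<noteq> \<infinity>" for i
      unfolding box by simp
    show "emeasure (density lborel (p x)) X = emeasure (density lborel (p 0)) X" if "X \<in> ?E" for X
      using that by (auto simp: box I_eq)
  qed
  then have "AE y in lborel. p x y = p 0 y"
    by (subst (asm) sigma_finite_measure.density_unique_iff[OF lborel.sigma_finite_measure_axioms]) auto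
  with ux[of x] C(2) show ?thesis
  proof eventually_elim
    case (elim y)
    have "0 \<le> u (y + x) + C" "0 \<le> u y + C" using elim(1,2) by linarith+
    then show ?case using elim(3) by (simp add: p_def)
  qed
qed

text \<open>For each shift, \<open>u\<close> agrees with its translate off a null set that depends
  on the shift. Fubini exchanges the quantifiers and yields one point \<open>y\<close> at which
  almost all shifts work; the constant is \<open>u y\<close>.\<close>

lemma AE_constant_if_correlation_constant:
  assumes u: "L_infty u" and eq: "\<And>\<psi> x. test_function \<psi> \<Longrightarrow> correlation u \<psi> x = correlation u \<psi> 0"
  shows "\<exists>c. AE y in lborel. u y = c"
proof -
  note [measurable] = L_infty_measurable[OF u]
  have "AE x in lborel. AE y in lborel. u (y + x) = u y"
    by (intro AE_I2 AE_shift_eq_if_correlation_eq u eq)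
  moreover have "{p \<in> space (lborel \<Otimes>\<^sub>M lborel). u (snd p + fst p) = u (snd p)} \<in> sets (lborel \<Otimes>\<^sub>M lborel)"
    by measurable
  ultimately have "AE y in lborel. AE x in lborel. u (y + x) = u y"
    by (subst (asm) lborel_pair.AE_commute) auto
  moreover have "ae_filter (lborel :: 'a measure) \<noteq> bot"
    by (simp add: ae_filter_eq_bot_iff)
  ultimately obtain y where "AE x in lborel. u (y + x) = u y"
    using eventually_happens' by blast
  then have "AE x in lborel. u (x + y) = u y" by (simp add: add.commute)
  then have "AE x in lborel. u (x + - y + y) = u y"
    by (rule AE_lborel_shift) measurable
  then show ?thesis by auto
qed

section \<open>Closed subgroups and integral functionals\<close>

text \<open>One basis vector \<open>w\<close> is enough: its component orthogonal to
  \<open>V\<close> and to the other basis vectors is nonzero, and scaled to take the value 1 at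
  \<open>w\<close> it kills everything else. For empty \<open>B\<close> any normal vector of
  \<open>V\<close> serves.\<close>

lemma exists_integral_functional:
  fixes V B :: "'a::euclidean_space set"
  assumes V: "subspace V" "V \<noteq> UNIV" and B: "independent B" and VB: "V \<inter> span B = {0}"
  shows "\<exists>n. n \<noteq> 0 \<and> (\<forall>v\<in>V. n \<bullet> v = 0) \<and> (\<forall>b\<in>B. n \<bullet> b \<in> \<int>)"
proof -
  have span_V: "span V = V" using V(1) by (simp only: span_eq_iff)
  show ?thesis
  proof (cases "B = {}")
    case True
    obtain x where x: "x \<notin> V" using V(2) by auto
    obtain y z where yz: "y \<in> span V" "\<And>w. w \<in> span V \<Longrightarrow> orthogonal z w" "x = y + z"
      using orthogonal_subspace_decomp_exists[of V x] by metis
    have "y \<in> V" using yz(1) span_V by simp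
    then have "z \<noteq> 0" using x yz(3) by auto
    moreover have "\<forall>v\<in>V. z \<bullet> v = 0" using yz(2) span_base[of _ V] by (simp add: orthogonal_def)
    ultimately show ?thesis using True by auto
  next
    case False
    then obtain w where w: "w \<in> B" by auto
    let ?U = "V \<union> (B - {w})"
    have w_notin: "w \<notin> span ?U"
    proof
      assume "w \<in> span ?U"
      then obtain v y where vy: "v \<in> V" "y \<in> span (B - {w})" "w = v + y"
        using span_V by (auto simp: span_Un)
      have "y \<in> span B" using vy(2) span_mono[of "B - {w}" B] by auto
      moreover have "w \<in> span B" using w by (rule span_base)
      ultimately have "w - y \<in> span B" by (simp add: span_diff)
      then have "v \<in> V \<inter> span B" using vy(1,3) by simp
      then have "w \<in> span (B - {w})" using VB vy(2,3) by simp
      then show False using B w by (auto simp: dependent_def)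
    qed
    obtain y z where yz: "y \<in> span ?U" "\<And>x. x \<in> span ?U \<Longrightarrow> orthogonal z x" "w = y + z"
      using orthogonal_subspace_decomp_exists[of ?U w] by metis
    have "z \<noteq> 0" using w_notin yz(1,3) by auto
    have "z \<bullet> w = z \<bullet> z" using yz(2)[OF yz(1)] by (simp add: yz(3) inner_add_right orthogonal_def)
    define n where "n = (1 / (z \<bullet> z)) *\<^sub>R z"
    have "n \<bullet> x = 0" if "x \<in> ?U" for x
      using yz(2)[OF span_base[OF that]] by (simp add: n_def orthogonal_def)
    moreover have "n \<bullet> w = 1" using \<open>z \<bullet> w = z \<bullet> z\<close> \<open>z \<noteq> 0\<close> by (simp add: n_def)
    moreover have "n \<noteq> 0" using \<open>z \<noteq> 0\<close> by (simp add: n_def)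
    ultimately show ?thesis
      by (intro exI[of _ n]) (metis Diff_iff Ints_0 Ints_1 Un_iff singletonD)
  qed
qed

section \<open>Structure of additive subgroups\<close>

locale additive_subgroup =
  fixes P :: "'a::euclidean_space set"
  assumes zero: "0 \<in> P" and add: "x \<in> P \<Longrightarrow> y \<in> P \<Longrightarrow> x + y \<in> P" and uminus: "x \<in> P \<Longrightarrow> - x \<in> P"
begin

lemma diff: "x \<in> P \<Longrightarrow> y \<in> P \<Longrightarrow> x - y \<in> P"
  using add[of x "- y"] uminus[of y] by simp

lemma nat_scale: "x \<in> P \<Longrightarrow> real k *\<^sub>R x \<in> P"
  by (induction k) (auto simp: zero add scaleR_left_distrib)

lemma int_scale: "x \<in> P \<Longrightarrow> of_int k *\<^sub>R x \<in> P"
  using nat_scale[of x "nat k"] uminus[OF nat_scale[of x "nat (- k)"]] by (cases "k \<ge> 0") auto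

lemma sum: "(\<And>i. i \<in> I \<Longrightarrow> f i \<in> P) \<Longrightarrow> (\<Sum>i\<in>I. f i) \<in> P"
  by (induction I rule: infinite_finite_induct) (auto simp: zero add)

text \<open>A sequence in the group that tends to \<open>0\<close> produces a line in the group: if \<open>x\<^sub>n / \<bar>x\<^sub>n\<bar>\<close> tends
  to \<open>e\<close>, then integer multiples of the \<open>x\<^sub>n\<close> approximate every multiple of \<open>e\<close>.\<close>

lemma contains_line:
  assumes "closed P" and "\<And>\<epsilon>. \<epsilon> > 0 \<Longrightarrow> \<exists>x\<in>P. x \<noteq> 0 \<and> norm x < \<epsilon>"
  shows "\<exists>e. e \<noteq> 0 \<and> (\<forall>t. t *\<^sub>R e \<in> P)"
proof -
  have "\<forall>n. \<exists>x. x \<in> P \<and> x \<noteq> 0 \<and> norm x < inverse (real (Suc n))"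
    using assms(2) by (metis inverse_positive_iff_positive of_nat_0_less_iff zero_less_Suc)
  from choice[OF this] obtain x where
    "\<forall>n. x n \<in> P \<and> x n \<noteq> 0 \<and> norm (x n) < inverse (real (Suc n))" by (rule exE)
  then have x: "x n \<in> P" "x n \<noteq> 0" "norm (x n) < inverse (real (Suc n))" for n by auto
  define y where "y n = x n /\<^sub>R norm (x n)" for n
  have "\<forall>n. y n \<in> sphere 0 1" using x(2) by (simp add: y_def)
  then obtain e r where e: "e \<in> sphere 0 1" "strict_mono r" "(y \<circ> r) \<longlonglongrightarrow> e"
    using compact_sphere[of "0::'a" 1] unfolding compact_def by metis
  have "(\<lambda>n. norm (x n)) \<longlonglongrightarrow> 0"
    using x(3) by (intro tendsto_sandwich[OF _ _ tendsto_const LIMSEQ_inverse_real_of_nat])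
      (auto intro!: always_eventually less_imp_le)
  then have lim0: "(\<lambda>n. norm (x (r n))) \<longlonglongrightarrow> 0"
    using LIMSEQ_subseq_LIMSEQ[OF _ e(2)] by (force simp: o_def)
  have "t *\<^sub>R e \<in> P" for t
  proof -
    \<comment> \<open>Rounding \<open>t / norm (x (r n))\<close> down to an integer costs at most 1,
      that is at most \<open>norm (x (r n))\<close> after rescaling, and this tends to 0.\<close>
    let ?c = "\<lambda>n. of_int \<lfloor>t / norm (x (r n))\<rfloor> * norm (x (r n))"
    have "\<bar>?c n - t\<bar> \<le> norm (x (r n))" for n
    proof -
      let ?s = "norm (x (r n))"
      have "?s > 0" using x(2) by simp
      have "\<bar>of_int \<lfloor>t / ?s\<rfloor> - t / ?s\<bar> \<le> 1" by linarith
      then have "\<bar>of_int \<lfloor>t / ?s\<rfloor> - t / ?s\<bar> * ?s \<le> 1 * ?s"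
        by (rule mult_right_mono) simp
      also have "\<bar>of_int \<lfloor>t / ?s\<rfloor> - t / ?s\<bar> * ?s = \<bar>(of_int \<lfloor>t / ?s\<rfloor> - t / ?s) * ?s\<bar>"
        by (simp add: abs_mult)
      also have "(of_int \<lfloor>t / ?s\<rfloor> - t / ?s) * ?s = ?c n - t"
        using \<open>?s > 0\<close> by (simp add: left_diff_distrib)
      finally show ?thesis by simp
    qed
    then have "(\<lambda>n. ?c n - t) \<longlonglongrightarrow> 0"
      by (intro Lim_null_comparison[OF _ lim0]) simp
    then have "?c \<longlonglongrightarrow> t" by (rule LIM_zero_cancel)
    then have "(\<lambda>n. ?c n *\<^sub>R (y \<circ> r) n) \<longlonglongrightarrow> t *\<^sub>R e"
      by (intro tendsto_scaleR e(3))
    moreover have "?c n *\<^sub>R (y \<circ> r) n = of_int \<lfloor>t / norm (x (r n))\<rfloor> *\<^sub>R x (r n)" for n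
      using x(2) by (simp add: y_def)
    ultimately have "(\<lambda>n. of_int \<lfloor>t / norm (x (r n))\<rfloor> *\<^sub>R x (r n)) \<longlonglongrightarrow> t *\<^sub>R e"
      by simp
    then show ?thesis
      by (rule closed_sequentially[OF assms(1), rotated]) (intro int_scale x(1))
  qed
  moreover have "e \<noteq> 0" using e(1) by auto
  ultimately show ?thesis by blast
qed

text \<open>Modulo a basis taken from a discrete group, every element has a representative in a bounded
  set, hence in a finite one; by the pigeonhole principle a fixed multiple of every element is an
  integral combination of the basis.\<close>

lemma discrete_integral_functional:
  assumes "\<epsilon> > 0" and discrete: "\<And>x. x \<in> P \<Longrightarrow> x \<noteq> 0 \<Longrightarrow> norm x \<ge> \<epsilon>"
    and B: "B \<subseteq> P" "independent B" "P \<subseteq> span B" and n: "\<And>b. b \<in> B \<Longrightarrow> n \<bullet> b \<in> \<int>"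
  shows "\<exists>k::nat. k > 0 \<and> (\<forall>x\<in>P. real k * (n \<bullet> x) \<in> \<int>)"
proof -
  have finB: "finite B" using B(2) by (rule independent_imp_finite)
  \<comment> \<open>Subtracting integer parts leaves coefficients of modulus at most 1, so the
    reduced element has norm at most \<open>R\<close>.\<close>
  define R where "R = (\<Sum>b\<in>B. norm b)"
  define F where "F = P \<inter> cball 0 R"
  have finF: "finite F"
  proof -
    have "uniform_discrete F"
      unfolding uniform_discrete_def
    proof (intro exI[of _ \<epsilon>] conjI ballI impI assms(1))
      fix x y assume xy: "x \<in> F" "y \<in> F" "dist x y < \<epsilon>"
      then have "x - y \<in> P" by (intro diff) (auto simp: F_def)
      from discrete[OF this] xy(3) show "x = y" by (auto simp: dist_norm)
    qed
    moreover have "bounded F"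
      by (rule bounded_subset[OF bounded_cball[of 0 R]]) (auto simp: F_def)
    ultimately show ?thesis
      by (intro uniform_discrete_finite_iff[THEN iffD1] conjI)
  qed
  have red: "\<exists>c. x - (\<Sum>b\<in>B. of_int (c b) *\<^sub>R b) \<in> F" if "x \<in> P" for x
  proof -
    let ?c = "\<lambda>b. representation B x b"
    have x: "(\<Sum>b\<in>B. ?c b *\<^sub>R b) = x"
      using that B finB by (intro sum_representation_eq) auto
    let ?q = "x - (\<Sum>b\<in>B. of_int \<lfloor>?c b\<rfloor> *\<^sub>R b)"
    have "?q = (\<Sum>b\<in>B. (?c b - of_int \<lfloor>?c b\<rfloor>) *\<^sub>R b)"
      by (simp add: x scaleR_left_diff_distrib sum_subtractf)
    also have "norm \<dots> \<le> (\<Sum>b\<in>B. norm ((?c b - of_int \<lfloor>?c b\<rfloor>) *\<^sub>R b))"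
      by (rule norm_sum)
    also have "\<dots> \<le> R"
      unfolding R_def
    proof (rule sum_mono)
      fix b
      have "\<bar>?c b - of_int \<lfloor>?c b\<rfloor>\<bar> \<le> 1" by linarith
      then show "norm ((?c b - of_int \<lfloor>?c b\<rfloor>) *\<^sub>R b) \<le> norm b"
        by (simp add: mult_left_le_one_le)
    qed
    finally have "norm ?q \<le> R" .
    moreover have "?q \<in> P" using B(1) that by (intro diff sum int_scale) auto
    ultimately show ?thesis by (intro exI[of _ "\<lambda>b. \<lfloor>?c b\<rfloor>"]) (simp add: F_def)
  qed
  have int_sum: "n \<bullet> (\<Sum>b\<in>B. of_int (c b) *\<^sub>R b) \<in> \<int>" for c :: "'a \<Rightarrow> int"
    unfolding inner_sum_right by (intro Ints_sum) (use n in auto)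
  \<comment> \<open>Two of the multiples of \<open>x\<close> by \<open>0, ..., card F\<close> share
    a representative. The difference of their indices is at most \<open>card F\<close>, hence
    divides the factorial, which is the same for all \<open>x\<close>.\<close>
  let ?k = "fact (card F) :: nat"
  have "real ?k * (n \<bullet> x) \<in> \<int>" if x: "x \<in> P" for x
  proof -
    have "\<forall>i::nat. \<exists>c. real i *\<^sub>R x - (\<Sum>b\<in>B. of_int (c b) *\<^sub>R b) \<in> F"
      by (intro allI red nat_scale x)
    from choice[OF this] obtain c where
      c: "\<forall>i::nat. real i *\<^sub>R x - (\<Sum>b\<in>B. of_int (c i b) *\<^sub>R b) \<in> F" by (rule exE)
    let ?q = "\<lambda>i. real i *\<^sub>R x - (\<Sum>b\<in>B. of_int (c i b) *\<^sub>R b)"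
    have "\<not> inj_on ?q {..card F}"
    proof
      assume "inj_on ?q {..card F}"
      then have "card {..card F} \<le> card F"
        using finF c by (intro card_inj_on_le[of ?q]) auto
      then show False by simp
    qed
    then obtain i' j' where ij': "i' \<le> card F" "j' \<le> card F" "i' \<noteq> j'" "?q i' = ?q j'"
      unfolding inj_on_def by auto
    define i where "i = min i' j'"
    define j where "j = max i' j'"
    have ij: "i \<le> card F" "j \<le> card F" "i < j"
      using ij'(1-3) by (auto simp: i_def j_def)
    have "?q i = ?q j"
      using ij'(4) by (cases "i' \<le> j'") (simp_all only: i_def j_def min_def max_def if_True if_False)
    then have "real j *\<^sub>R x - real i *\<^sub>R x = (\<Sum>b\<in>B. of_int (c j b) *\<^sub>R b) - (\<Sum>b\<in>B. of_int (c i b) *\<^sub>R b)"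
      by (simp add: algebra_simps)
    then have "n \<bullet> (real j *\<^sub>R x - real i *\<^sub>R x) = n \<bullet> (\<Sum>b\<in>B. of_int (c j b) *\<^sub>R b) - n \<bullet> (\<Sum>b\<in>B. of_int (c i b) *\<^sub>R b)"
      by (simp only: inner_diff_right)
    also have "\<dots> \<in> \<int>" by (intro Ints_diff int_sum)
    finally have int: "real (j - i) * (n \<bullet> x) \<in> \<int>"
      using ij(3) by (simp add: inner_diff_right of_nat_diff left_diff_distrib)
    have "j - i dvd ?k" using ij by (intro dvd_fact) auto
    then obtain l where l: "?k = (j - i) * l" by (rule dvdE)
    have "real ?k * (n \<bullet> x) = real l * (real (j - i) * (n \<bullet> x))"
      unfolding l by (simp only: of_nat_mult mult_ac)
    also have "\<dots> \<in> \<int>" by (rule Ints_mult[OF Ints_of_nat int])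
    finally show ?thesis .
  qed
  then show ?thesis by (intro exI[of _ ?k]) simp
qed

text \<open>\<open>V\<close> is the largest subspace inside \<open>P\<close>, and \<open>W\<close>
  is its orthogonal complement. A line in \<open>P \<inter> W\<close> would have its direction in
  both, so \<open>P \<inter> W\<close> is discrete. Since \<open>P\<close> is the sum of
  \<open>V\<close> and \<open>P \<inter> W\<close>, a functional that vanishes on \<open>V\<close>
  and is integral on a basis taken from \<open>P \<inter> W\<close> becomes integral on
  \<open>P\<close> after multiplication by some \<open>k\<close>.\<close>

lemma proper_closed_integral_functional:
  assumes "closed P" and "P \<noteq> UNIV"
  shows "\<exists>n. n \<noteq> 0 \<and> (\<forall>x\<in>P. n \<bullet> x \<in> \<int>)"
proof -
  define V where "V = {x. \<forall>t. t *\<^sub>R x \<in> P}"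
  have V: "subspace V"
    by (auto simp: V_def subspace_def zero add scaleR_right_distrib)
  have VP: "V \<subseteq> P"
  proof
    fix x assume "x \<in> V"
    then have "1 *\<^sub>R x \<in> P" unfolding V_def by blast
    then show "x \<in> P" by simp
  qed
  then have "V \<noteq> UNIV" using assms(2) by auto
  define W where "W = {x. \<forall>v\<in>V. x \<bullet> v = 0}"
  have W: "subspace W"
    by (auto simp: W_def subspace_def inner_add_left)
  interpret D: additive_subgroup "P \<inter> W"
    using W by unfold_locales (auto simp: zero add uminus subspace_0 subspace_add subspace_neg)
  have closedD: "closed (P \<inter> W)" by (rule closed_Int[OF assms(1) closed_subspace[OF W]])
  have VW: "x = 0" if "x \<in> V" "x \<in> W" for x
    using that by (auto simp: W_def)
  have "\<exists>\<epsilon>>0. \<forall>x\<in>P \<inter> W. x \<noteq> 0 \<longrightarrow> norm x \<ge> \<epsilon>"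
  proof (rule ccontr)
    assume neg: "\<not> (\<exists>\<epsilon>>0. \<forall>x\<in>P \<inter> W. x \<noteq> 0 \<longrightarrow> norm x \<ge> \<epsilon>)"
    have "\<exists>x\<in>P \<inter> W. x \<noteq> 0 \<and> norm x < \<epsilon>" if "\<epsilon> > 0" for \<epsilon>
      using neg that by (meson not_le)
    from D.contains_line[OF closedD this]
    obtain e where e: "e \<noteq> 0" "\<And>t. t *\<^sub>R e \<in> P \<inter> W" by blast
    have "e \<in> V" using e(2) by (simp add: V_def)
    moreover have "e \<in> W" using e(2)[of 1] by simp
    ultimately show False using VW e(1) by blast
  qed
  then obtain \<epsilon> where e: "\<epsilon> > 0" "\<And>x. x \<in> P \<inter> W \<Longrightarrow> x \<noteq> 0 \<Longrightarrow> norm x \<ge> \<epsilon>"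
    by blast
  obtain B where B: "B \<subseteq> P \<inter> W" "independent B" "P \<inter> W \<subseteq> span B"
    using maximal_independent_subset[of "P \<inter> W"] by metis
  have "span B \<subseteq> W" using B(1) W by (intro span_minimal) auto
  then have "V \<inter> span B = {0}"
    using VW V by (auto simp: subspace_0 span_zero)
  from exists_integral_functional[OF V \<open>V \<noteq> UNIV\<close> B(2) this]
  obtain n where n: "n \<noteq> 0" "\<And>v. v \<in> V \<Longrightarrow> n \<bullet> v = 0" "\<And>b. b \<in> B \<Longrightarrow> n \<bullet> b \<in> \<int>"
    by blast
  from D.discrete_integral_functional[OF e B n(3)]
  obtain k :: nat where k: "k > 0" "\<And>x. x \<in> P \<inter> W \<Longrightarrow> real k * (n \<bullet> x) \<in> \<int>"
    by blast
  have "(real k *\<^sub>R n) \<bullet> x \<in> \<int>" if x: "x \<in> P" for x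
  proof -
    obtain y z where yz: "y \<in> span V" "\<And>w. w \<in> span V \<Longrightarrow> orthogonal z w" "x = y + z"
      using orthogonal_subspace_decomp_exists[of V x] by metis
    have "span V = V" using V by (simp only: span_eq_iff)
    then have y: "y \<in> V" using yz(1) by blast
    then have "z \<in> P" using diff[OF x, of y] VP yz(3) by auto
    moreover have "z \<in> W" using yz(2) span_base[of _ V] by (simp add: W_def orthogonal_def)
    ultimately have "real k * (n \<bullet> z) \<in> \<int>" using k(2) by blast
    then show ?thesis using n(2)[OF y] by (simp add: yz(3) inner_add_right)
  qed
  then show ?thesis using n(1) k(1) by (intro exI[of _ "real k *\<^sub>R n"]) auto
qed

end

section \<open>Restrictions of a Levy measure\<close>

text \<open>The integrals of the norms have partial sums bounded by the integral of
  \<open>\<bar>g z\<bar>\<close>. Convergence is therefore absolute, and the enumeration of the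
  integers by \<open>int_decode\<close> leaves no trace in the result.\<close>

lemma has_sum_integral_partition:
  fixes g :: "'a \<Rightarrow> real" and T :: "int \<Rightarrow> 'a set"
  assumes T: "\<And>k. T k \<in> sets M" and disj: "\<And>j k. j \<noteq> k \<Longrightarrow> T j \<inter> T k = {}" and g: "integrable M g"
  shows "((\<lambda>k. \<integral>z. indicator (T k) z * g z \<partial>M) has_sum (\<integral>z. indicator (\<Union>k. T k) z * g z \<partial>M)) UNIV"
proof -
  let ?d = "int_decode"
  define f where "f i z = indicator (T (?d i)) z * g z" for i z
  have disj': "T (?d i) \<inter> T (?d j) = {}" if "i \<noteq> j" for i j
    using that disj by (metis int_decode_inverse)
  have ind: "(\<lambda>i. indicator (T (?d i)) z :: real) sums indicator (\<Union>i. T (?d i)) z" for z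
    by (rule indicator_sums[OF disj'])
  have Un: "(\<Union>i. T (?d i)) = (\<Union>k. T k)"
    using bij_int_decode by (metis bij_betw_imp_surj_on image_image)
  have f_sums: "(\<lambda>i. f i z) sums (indicator (\<Union>k. T k) z * g z)" for z
    using sums_mult2[OF ind[of z], of "g z"] by (simp only: f_def Un)
  have norm_f: "norm (f i z) = indicator (T (?d i)) z * \<bar>g z\<bar>" for i z
    by (simp add: f_def abs_mult)
  have norm_sums: "(\<lambda>i. norm (f i z)) sums (indicator (\<Union>k. T k) z * \<bar>g z\<bar>)" for z
    using sums_mult2[OF ind[of z], of "\<bar>g z\<bar>"] by (simp only: norm_f Un)
  have int_f: "integrable M (f i)" for i
    unfolding f_def[abs_def] using integrable_mult_indicator[OF T g] by simp
  have summ: "summable (\<lambda>i. \<integral>z. norm (f i z) \<partial>M)"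
  proof (rule summableI_nonneg_bounded)
    show "0 \<le> (\<integral>z. norm (f i z) \<partial>M)" for i by simp
    show "(\<Sum>i<n. \<integral>z. norm (f i z) \<partial>M) \<le> (\<integral>z. \<bar>g z\<bar> \<partial>M)" for n
    proof -
      have "(\<Sum>i<n. \<integral>z. norm (f i z) \<partial>M) = (\<integral>z. (\<Sum>i<n. norm (f i z)) \<partial>M)"
        using int_f by (intro Bochner_Integration.integral_sum[symmetric] integrable_norm)
      also have "\<dots> \<le> (\<integral>z. \<bar>g z\<bar> \<partial>M)"
      proof (rule integral_mono)
        show "integrable M (\<lambda>z. \<Sum>i<n. norm (f i z))"
          using int_f by (intro Bochner_Integration.integrable_sum integrable_norm)
        show "integrable M (\<lambda>z. \<bar>g z\<bar>)" using g by simp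
        show "(\<Sum>i<n. norm (f i z)) \<le> \<bar>g z\<bar>" for z
        proof -
          have "(\<Sum>i<n. norm (f i z)) \<le> indicator (\<Union>k. T k) z * \<bar>g z\<bar>"
            using sum_le_suminf[OF sums_summable[OF norm_sums[of z]], of "{..<n}"]
            by (simp add: sums_unique[OF norm_sums[of z]])
          also have "\<dots> \<le> \<bar>g z\<bar>" by (simp add: indicator_def)
          finally show ?thesis .
        qed
      qed
      finally show ?thesis .
    qed
  qed
  have "(\<lambda>i. \<integral>z. f i z \<partial>M) sums (\<integral>z. (\<Sum>i. f i z) \<partial>M)"
    by (rule sums_integral[OF int_f AE_I2[OF sums_summable[OF norm_sums]] summ])
  also have "(\<lambda>z. \<Sum>i. f i z) = (\<lambda>z. indicator (\<Union>k. T k) z * g z)"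
    using sums_unique[OF f_sums] by auto
  finally have sums: "(\<lambda>i. \<integral>z. f i z \<partial>M) sums (\<integral>z. indicator (\<Union>k. T k) z * g z \<partial>M)" .
  have "summable (\<lambda>i. norm (\<integral>z. f i z \<partial>M))"
    by (rule summable_comparison_test[OF _ summ]) (auto intro: integral_norm_bound)
  from norm_summable_imp_has_sum[OF this sums]
  have "((\<lambda>i. (\<lambda>k. \<integral>z. indicator (T k) z * g z \<partial>M) (?d i)) has_sum (\<integral>z. indicator (\<Union>k. T k) z * g z \<partial>M)) UNIV"
    by (simp add: f_def)
  then show ?thesis
    by (subst (asm) has_sum_reindex_bij_betw[OF bij_int_decode])
qed

lemma
  fixes f :: "'a \<Rightarrow> real"
  assumes A: "A \<in> sets M" and f: "f \<in> borel_measurable M"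
  shows integrable_restricted: "integrable (density M (indicator A)) f \<longleftrightarrow> integrable M (\<lambda>z. indicator A z * f z)"
    and integral_restricted: "(\<integral>z. f z \<partial>density M (indicator A)) = (\<integral>z. indicator A z * f z \<partial>M)"
proof -
  have eq: "density M (indicator A) = density M (\<lambda>z. ennreal (indicator A z))"
    by (simp add: ennreal_indicator)
  show "integrable (density M (indicator A)) f \<longleftrightarrow> integrable M (\<lambda>z. indicator A z * f z)"
    unfolding eq using A f by (subst integrable_density) auto
  show "(\<integral>z. f z \<partial>density M (indicator A)) = (\<integral>z. indicator A z * f z \<partial>M)"
    unfolding eq using A f by (subst integral_density) auto
qed

lemma correlation_eq_shifted:
  assumes "L_infty u" "test_function \<psi>"
  shows "correlation u \<psi> x = (LINT y|lborel. u (y + x) * \<psi> y)"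
proof -
  note [measurable] = L_infty_measurable[OF assms(1)] test_function_measurable[OF assms(2)]
  show ?thesis
    using integral_lborel_shift[of "\<lambda>y. u y * \<psi> (y - x)" x] by (simp add: correlation_def)
qed

section \<open>Symmetric restrictions and jump measures of finite mass\<close>

context levy_measure
begin

lemma uminus_image_sets: "B \<in> sets \<nu> \<Longrightarrow> uminus ` B \<in> sets \<nu>"
proof -
  assume B: "B \<in> sets \<nu>"
  then have "0 \<notin> B" using sets.sets_into_space space_eq by blast
  moreover have "uminus ` B = uminus -` B" by (force simp: image_iff)
  moreover have "uminus -` B \<inter> space borel \<in> sets borel"
    by (rule measurable_sets[OF _ sets_imp_borel[OF B]]) measurable
  ultimately show ?thesis by (intro borel_imp_sets) auto
qed

lemma emeasure_uminus: "B \<in> sets \<nu> \<Longrightarrow> emeasure \<nu> (uminus ` B) = emeasure \<nu> B"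
  using reflected by (simp add: reflected_def)

lemma emeasure_restricted_uminus:
  assumes "A \<in> sets \<nu>" and "B \<in> sets \<nu>"
  shows "emeasure (density \<nu> (indicator A)) B = emeasure (density \<nu> (indicator (uminus ` A))) (uminus ` B)"
proof -
  have "uminus ` A \<inter> uminus ` B = uminus ` (A \<inter> B)" by auto
  then show ?thesis
    using assms by (simp add: emeasure_restricted uminus_image_sets emeasure_uminus)
qed

lemma levy_measure_restricted:
  assumes A: "A \<in> sets \<nu>" and sym: "uminus ` A = A"
  shows "levy_measure (density \<nu> (indicator A))"
proof
  show "sets (density \<nu> (indicator A)) = sets (restrict_space borel (- {0}))"
    by (simp add: sets_eq)
  show "reflected (density \<nu> (indicator A)) (density \<nu> (indicator A))"
    using emeasure_restricted_uminus[OF A] by (simp add: reflected_def sym)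
  have "(\<lambda>z. ennreal (min ((norm z)\<^sup>2) 1)) \<in> borel_measurable \<nu>"
    by (rule measurable_from_borel) measurable
  then have "levy_mass (density \<nu> (indicator A)) = (\<integral>\<^sup>+z. indicator A z * ennreal (min ((norm z)\<^sup>2) 1) \<partial>\<nu>)"
    unfolding levy_mass_def by (intro nn_integral_density) (use A in simp)
  also have "\<dots> \<le> levy_mass \<nu>"
    unfolding levy_mass_def by (intro nn_integral_mono) (auto simp: indicator_def)
  finally show "levy_mass (density \<nu> (indicator A)) < \<infinity>"
    using levy_mass by (rule order.strict_trans1)
qed

lemma integrable_pair_jump:
  assumes fin: "emeasure \<nu> (space \<nu>) < \<infinity>" and "L_infty u" "test_function \<psi>"
  shows "integrable (lborel \<Otimes>\<^sub>M \<nu>) (\<lambda>(x, z). (u (x + z) - u x) * \<psi> x)"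
proof (rule integrableI_bounded)
  interpret P: pair_sigma_finite lborel \<nu> by (rule pair_sigma_finite)
  note [measurable] = L_infty_measurable[OF assms(2)] test_function_measurable[OF assms(3)]
  let ?f = "\<lambda>(x, z). (u (x + z) - u x) * \<psi> x"
  show meas: "?f \<in> borel_measurable (lborel \<Otimes>\<^sub>M \<nu>)"
    by (rule measurable_pair_from_borel) measurable
  obtain K where K: "K \<ge> 0" "AE x in lborel. \<bar>u x\<bar> \<le> K" using L_inftyE[OF assms(2)] by metis
  let ?D = "\<integral>x. 2 * K * \<bar>\<psi> x\<bar> \<partial>lborel"
  have inner: "(\<integral>\<^sup>+x. ennreal (norm (?f (x, z))) \<partial>lborel) \<le> ennreal ?D" for z
  proof -
    \<comment> \<open>The null set on which the bound fails moves with \<open>z\<close>, so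
      \<open>z\<close> is kept fixed and the integration over \<open>x\<close> comes first.\<close>
    have uz: "AE x in lborel. \<bar>u (x + z)\<bar> \<le> K"
      by (rule AE_lborel_shift[OF K(2)]) measurable
    have "(\<integral>\<^sup>+x. ennreal (norm (?f (x, z))) \<partial>lborel) \<le> (\<integral>\<^sup>+x. ennreal (2 * K * \<bar>\<psi> x\<bar>) \<partial>lborel)"
    proof (rule nn_integral_mono_AE)
      show "AE x in lborel. ennreal (norm (?f (x, z))) \<le> ennreal (2 * K * \<bar>\<psi> x\<bar>)"
        using K(2) uz
      proof eventually_elim
        case (elim x)
        have "\<bar>u (x + z) - u x\<bar> \<le> 2 * K" using elim by linarith
        then have "\<bar>u (x + z) - u x\<bar> * \<bar>\<psi> x\<bar> \<le> 2 * K * \<bar>\<psi> x\<bar>" by (rule mult_right_mono) simp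
        then show ?case by (intro ennreal_leI) (simp add: abs_mult)
      qed
    qed
    also have "\<dots> = ennreal ?D"
      using test_function_integrable[OF assms(3)] K(1) by (intro nn_integral_eq_integral) auto
    finally show ?thesis .
  qed
  have "(\<integral>\<^sup>+p. ennreal (norm (?f p)) \<partial>(lborel \<Otimes>\<^sub>M \<nu>)) = (\<integral>\<^sup>+z. \<integral>\<^sup>+x. ennreal (norm (?f (x, z))) \<partial>lborel \<partial>\<nu>)"
    by (rule P.nn_integral_snd[symmetric]) (use meas in measurable)
  also have "\<dots> \<le> (\<integral>\<^sup>+z. ennreal ?D \<partial>\<nu>)"
    by (intro nn_integral_mono inner)
  also have "\<dots> = ennreal ?D * emeasure \<nu> (space \<nu>)" by simp
  also have "\<dots> < \<infinity>" using fin by (simp add: ennreal_mult_less_top)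
  finally show "(\<integral>\<^sup>+p. ennreal (norm (?f p)) \<partial>(lborel \<Otimes>\<^sub>M \<nu>)) < \<infinity>" .
qed

text \<open>For a fixed jump, translation turns the increment of \<open>u\<close> into an increment
  of its correlation from 0 to \<open>z\<close>. Adding the one for \<open>- z\<close>, allowed by
  symmetry, gives the second difference at 0, which moves on to \<open>\<psi>\<close>.\<close>

lemma integral_jump_eq:
  assumes fin: "emeasure \<nu> (space \<nu>) < \<infinity>" and u: "L_infty u" and \<psi>: "test_function \<psi>"
  shows "(\<integral>x. \<integral>z. (u (x + z) - u x) * \<psi> x \<partial>\<nu> \<partial>lborel) =
    (\<integral>z. \<integral>x. u x * second_diff \<psi> z x \<partial>lborel \<partial>\<nu>) / 2"
proof -
  interpret P: pair_sigma_finite lborel \<nu> by (rule pair_sigma_finite)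
  define F where "F z = (\<integral>x. (u (x + z) - u x) * \<psi> x \<partial>lborel)" for z
  have F_int: "integrable \<nu> F"
    unfolding F_def[abs_def] by (rule P.integrable_snd[OF integrable_pair_jump[OF assms]])
  have F_eq: "F z = correlation u \<psi> z - correlation u \<psi> 0" for z
  proof -
    have "integrable lborel (\<lambda>x. u (x + c) * \<psi> x)" for c
      using integrable_lborel_shift[OF correlation_integrable[OF u \<psi>, of c], of c] by simp
    from this[of z] this[of 0] show ?thesis
      by (simp add: F_def correlation_eq_shifted[OF u \<psi>] left_diff_distrib)
  qed
  have "(\<integral>x. \<integral>z. (u (x + z) - u x) * \<psi> x \<partial>\<nu> \<partial>lborel) = (\<integral>z. F z \<partial>\<nu>)"
    unfolding F_def by (rule P.Fubini_integral[symmetric, OF integrable_pair_jump[OF assms]])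
  moreover have "(\<integral>z. F (- z) \<partial>\<nu>) = (\<integral>z. F z \<partial>\<nu>)"
    by (rule integral_uminus[OF borel_measurable_integrable[OF F_int]])
  moreover have "(\<integral>z. F z + F (- z) \<partial>\<nu>) = (\<integral>z. F z \<partial>\<nu>) + (\<integral>z. F (- z) \<partial>\<nu>)"
    by (rule Bochner_Integration.integral_add[OF F_int integrable_uminus[OF F_int]])
  moreover have "F z + F (- z) = (\<integral>x. u x * second_diff \<psi> z x \<partial>lborel)" for z
    using second_diff_correlation[OF u \<psi>, of z 0] by (simp add: F_eq second_diff_def)
  ultimately show ?thesis by simp
qed

lemma integral_functional_of_solution:
  assumes u: "L_infty u" "nonconstant u" and sol: "\<And>\<psi>. test_function \<psi> \<Longrightarrow> levy_dist \<nu> u \<psi> = 0"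
  shows "\<exists>n. n \<noteq> 0 \<and> (AE z in \<nu>. n \<bullet> z \<in> \<int>)"
proof -
  \<comment> \<open>Periods of the correlations rather than of \<open>u\<close> itself: correlations
    are continuous, so each condition defines a closed set.\<close>
  define P where "P = {p. \<forall>\<psi> x. test_function \<psi> \<longrightarrow> correlation u \<psi> (x + p) = correlation u \<psi> x}"
  have PD: "correlation u \<psi> (x + p) = correlation u \<psi> x" if "p \<in> P" "test_function \<psi>" for p \<psi> x
    using that by (simp add: P_def)
  interpret additive_subgroup P
  proof
    show "0 \<in> P" by (simp add: P_def)
    show "p + q \<in> P" if "p \<in> P" "q \<in> P" for p q
    proof -
      have "correlation u \<psi> (x + (p + q)) = correlation u \<psi> x" if \<psi>: "test_function \<psi>" for \<psi> x
        using PD[OF \<open>p \<in> P\<close> \<psi>, of x] PD[OF \<open>q \<in> P\<close> \<psi>, of "x + p"] by (simp only: add.assoc)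
      then show ?thesis by (simp add: P_def)
    qed
    show "- p \<in> P" if "p \<in> P" for p
    proof -
      have "correlation u \<psi> (x + - p) = correlation u \<psi> x" if \<psi>: "test_function \<psi>" for \<psi> x
        using PD[OF \<open>p \<in> P\<close> \<psi>, of "x + - p"] by simp
      then show ?thesis by (simp add: P_def)
    qed
  qed
  have closed_eq: "closed {p. correlation u \<psi> (x + p) = correlation u \<psi> x}" if \<psi>: "test_function \<psi>" for \<psi> x
  proof -
    obtain L where L: "L \<ge> 0" "\<And>x y. \<bar>correlation u \<psi> x - correlation u \<psi> y\<bar> \<le> L * norm (x - y)"
      using correlation_lipschitz[OF u(1) \<psi>] by metis
    then have "L-lipschitz_on UNIV (correlation u \<psi>)"
      by (intro lipschitz_onI) (auto simp: dist_norm)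
    then have cont: "continuous_on UNIV (correlation u \<psi>)"
      by (rule lipschitz_on_continuous_on)
    have "continuous_on UNIV (\<lambda>p. correlation u \<psi> (x + p))"
      by (rule continuous_on_compose2[OF cont]) (auto intro: continuous_intros)
    then show ?thesis
      by (rule closed_Collect_eq) (rule continuous_on_const)
  qed
  have P_eq: "P = (\<Inter>\<psi>\<in>Collect test_function. \<Inter>x. {p. correlation u \<psi> (x + p) = correlation u \<psi> x})"
    unfolding P_def by blast
  have "closed P"
    unfolding P_eq by (intro closed_INT ballI closed_eq) simp
  have "P \<noteq> UNIV"
  proof
    assume P: "P = UNIV"
    have "correlation u \<psi> x = correlation u \<psi> 0" if \<psi>: "test_function \<psi>" for \<psi> x
    proof -
      have "x \<in> P" by (simp add: P)
      from PD[OF this \<psi>, of 0] show ?thesis by simp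
    qed
    from AE_constant_if_correlation_constant[OF u(1) this] u(2) show False
      by (simp add: nonconstant_def)
  qed
  from proper_closed_integral_functional[OF \<open>closed P\<close> this]
  obtain n where n: "n \<noteq> 0" "\<forall>x\<in>P. n \<bullet> x \<in> \<int>"
    by blast
  have "supp \<nu> \<subseteq> P"
  proof
    fix p assume p: "p \<in> supp \<nu>"
    have "correlation u \<psi> (x + p) = correlation u \<psi> x" if "test_function \<psi>" for \<psi> x
      by (rule correlation_periodic[OF u(1) sol that p])
    then show "p \<in> P" by (simp add: P_def)
  qed
  from AE_in_closed[OF \<open>closed P\<close> this] have "AE z in \<nu>. n \<bullet> z \<in> \<int>"
    by eventually_elim (use n(2) in blast)
  then show ?thesis using n(1) by blast
qed

text \<open>A jump contributes the second difference of a correlation at 0, which vanishes when the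
  jump is a period of \<open>u\<close>.\<close>

lemma levy_dist_periodic_eq_0:
  assumes u: "L_infty u" and \<psi>: "test_function \<psi>" and "AE z in \<nu>. \<forall>x. u (x + z) = u x"
  shows "levy_dist \<nu> u \<psi> = 0"
proof -
  have "AE z in \<nu>. (\<integral>x. u x * second_diff \<psi> z x \<partial>lborel) = 0"
    using assms(3)
  proof eventually_elim
    case (elim z)
    then have "u (x - z) = u x" for x
      using elim[rule_format, of "x - z"] by simp
    then have "correlation u \<psi> z = correlation u \<psi> 0" "correlation u \<psi> (- z) = correlation u \<psi> 0"
      using elim by (simp_all add: correlation_eq_shifted[OF u \<psi>])
    then show ?case
      using second_diff_correlation[OF u \<psi>, of z 0] by (simp add: second_diff_def)
  qed
  then show ?thesis
    by (simp add: levy_dist_eq[OF u \<psi>] integral_eq_zero_AE)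
qed

end

section \<open>Slicing along an integral functional\<close>

text \<open>For real terms unordered summability is absolute convergence, and \<open>infsum\<close>
  is 0 where it fails. The right-hand side makes measurability in a parameter evident, the default
  value included.\<close>

lemma infsum_nat_real:
  fixes h :: "nat \<Rightarrow> real"
  shows "(\<Sum>\<^sub>\<infinity>i. h i) = (if (\<Sum>i. ennreal \<bar>h i\<bar>) \<noteq> top then \<Sum>i. h i else 0)"
proof (cases "(\<Sum>i. ennreal \<bar>h i\<bar>) \<noteq> top")
  case True
  then have summ: "summable (\<lambda>i. norm (h i))"
    by (intro summable_suminf_not_top) auto
  have "(h has_sum (\<Sum>i. h i)) UNIV"
    by (rule norm_summable_imp_has_sum[OF summ summable_sums[OF summable_norm_cancel[OF summ]]])
  then show ?thesis unfolding if_P[OF True] by (rule infsumI)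
next
  case False
  have "\<not> h summable_on UNIV"
  proof
    assume "h summable_on UNIV"
    then have "(\<lambda>i. norm (h i)) summable_on UNIV"
      by (rule summable_on_iff_abs_summable_on_real[THEN iffD1])
    then have "summable (\<lambda>i. norm (h i))"
      by (rule summable_on_imp_summable)
    then have "(\<Sum>i. ennreal (norm (h i))) \<noteq> top"
      by (rule ennreal_suminf_neq_top) simp
    then show False using False by (simp only: real_norm_def)
  qed
  then show ?thesis unfolding if_not_P[OF False] by (rule infsum_not_exists)
qed

lemma borel_measurable_infsum_int:
  fixes f :: "int \<Rightarrow> 'b \<Rightarrow> real"
  assumes [measurable]: "\<And>k. f k \<in> borel_measurable M"
  shows "(\<lambda>x. \<Sum>\<^sub>\<infinity>k. f k x) \<in> borel_measurable M"
proof -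
  have "(\<Sum>\<^sub>\<infinity>k. f k x) = (\<Sum>\<^sub>\<infinity>i. f (int_decode i) x)" for x
    by (rule infsum_reindex_bij_betw[OF bij_int_decode, symmetric])
  then show ?thesis
    unfolding infsum_nat_real by simp
qed

locale levy_measure_integral = levy_measure \<nu> for \<nu> :: "'a::euclidean_space measure" +
  fixes n :: "'a"
  assumes n: "n \<noteq> 0" and integral: "AE z in \<nu>. n \<bullet> z \<in> \<int>"
begin

definition slab :: "real \<Rightarrow> 'a set" where
  "slab t = {z. z \<noteq> 0 \<and> n \<bullet> z = t}"

text \<open>A density with respect to \<open>\<nu>\<close> keeps the space and the sigma-algebra.
  The measure depends on \<open>a\<close> only through the level
  \<open>n \<bullet> a\<close>.\<close>

definition slice :: "'a \<Rightarrow> 'a measure" where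
  "slice a = density \<nu> (indicator (slab (n \<bullet> a)))"

definition kernel :: "'a set" where
  "kernel = {v. n \<bullet> v = 0}"

text \<open>The point at level 1 on the line through \<open>n\<close>, so that its multiple by
  \<open>k\<close> represents the hyperplane at level \<open>k\<close>.\<close>

definition generator :: "'a" where
  "generator = n /\<^sub>R (n \<bullet> n)"

definition lattice :: "'a set" where
  "lattice = range (\<lambda>k. of_int k *\<^sub>R generator)"

text \<open>Level 0 is emptied rather than left out, so that unions and sums may range over all
  integers.\<close>

definition jumps :: "int \<Rightarrow> 'a set" where
  "jumps k = (if k = 0 then {} else slab (of_int k))"

lemma inner_generator: "n \<bullet> generator = 1"
  using n by (simp add: generator_def)

lemma subspace_kernel: "subspace kernel"
  by (auto simp: kernel_def subspace_def inner_add_right)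

lemma kernel_neq_UNIV: "kernel \<noteq> UNIV"
proof
  assume "kernel = UNIV"
  then have "n \<in> kernel" by simp
  then show False using n by (simp add: kernel_def)
qed

lemma relative_lattice_lattice: "relative_lattice lattice"
  unfolding relative_lattice_def
proof (intro exI conjI)
  show "finite {generator}" by simp
  show "independent {generator}" using inner_generator by auto
  show "lattice = {\<Sum>b\<in>{generator}. of_int (c b) *\<^sub>R b |c :: 'a \<Rightarrow> int. True}"
  proof (intro set_eqI iffI)
    fix x assume "x \<in> {\<Sum>b\<in>{generator}. of_int (c b) *\<^sub>R b |c :: 'a \<Rightarrow> int. True}"
    then show "x \<in> lattice" by (auto simp: lattice_def)
  next
    fix x assume "x \<in> lattice"
    then obtain k where "x = of_int k *\<^sub>R generator" unfolding lattice_def by (rule rangeE)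
    then show "x \<in> {\<Sum>b\<in>{generator}. of_int (c b) *\<^sub>R b |c :: 'a \<Rightarrow> int. True}"
      by (intro CollectI exI[of _ "\<lambda>_. k"]) simp
  qed
qed

lemma kernel_Int_span: "kernel \<inter> span lattice = {0}"
proof -
  have "lattice \<subseteq> span {generator}"
    by (auto simp: lattice_def intro: span_scale span_base)
  then have "span lattice \<subseteq> span {generator}" by (rule span_minimal) simp
  moreover have "x = 0" if "x \<in> kernel" "x \<in> span {generator}" for x
    using that inner_generator by (auto simp: kernel_def span_singleton)
  ultimately have "kernel \<inter> span lattice \<subseteq> {0}" by blast
  then show ?thesis using subspace_0[OF subspace_kernel] span_zero by blast
qed

lemma kernel_translate: "{v + a |v. v \<in> kernel} = {z. n \<bullet> z = n \<bullet> a}"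
proof (intro set_eqI iffI)
  fix z assume "z \<in> {z. n \<bullet> z = n \<bullet> a}"
  then show "z \<in> {v + a |v. v \<in> kernel}"
    by (auto simp: kernel_def inner_diff_right intro!: exI[of _ "z - a"])
qed (auto simp: kernel_def inner_add_right)

lemma slab_sets: "slab t \<in> sets \<nu>"
proof (rule borel_imp_sets)
  have "slab t = {z. n \<bullet> z = t} - {0}" by (auto simp: slab_def)
  then show "slab t \<in> sets borel" by (simp add: borel_closed closed_hyperplane)
qed (simp add: slab_def)

lemma jumps_sets: "jumps k \<in> sets \<nu>"
  by (simp add: jumps_def slab_sets)

lemma jumps_disjoint: "j \<noteq> k \<Longrightarrow> jumps j \<inter> jumps k = {}"
  by (auto simp: jumps_def slab_def)

lemma slab_uminus: "uminus ` slab t = slab (- t)"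
proof (intro set_eqI iffI)
  fix z assume "z \<in> slab (- t)"
  then have "- z \<in> slab t" by (simp add: slab_def)
  then have "- (- z) \<in> uminus ` slab t" by (rule imageI)
  then show "z \<in> uminus ` slab t" by simp
qed (auto simp: slab_def)

lemma Union_jumps_uminus: "uminus ` (\<Union>k. jumps k) = (\<Union>k. jumps k)"
proof -
  have "uminus ` jumps k = jumps (- k)" for k
    by (simp add: jumps_def slab_uminus)
  then have "uminus ` (\<Union>k. jumps k) = (\<Union>k. jumps (- k))" by (simp add: image_UN)
  also have "\<dots> = (\<Union>k. jumps k)"
    by (intro set_eqI iffI) (auto, metis minus_minus)
  finally show ?thesis .
qed

text \<open>A nonzero integer has modulus at least 1, so Cauchy-Schwarz gives
  \<open>norm z \<ge> 1 / norm n\<close>; the factor 2 makes the inequality strict.\<close>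

lemma jumps_away:
  assumes "z \<in> jumps k"
  shows "norm z > 1 / (2 * norm n)"
proof -
  have "k \<noteq> 0" "n \<bullet> z = of_int k" using assms by (auto simp: jumps_def slab_def split: if_splits)
  then have "1 \<le> \<bar>n \<bullet> z\<bar>" by simp
  also have "\<dots> \<le> norm n * norm z" by (rule Cauchy_Schwarz_ineq2)
  finally have "1 \<le> norm n * norm z" .
  moreover have "norm n > 0" using n by simp
  ultimately show ?thesis by (simp add: field_simps)
qed

lemma emeasure_jumps_finite: "emeasure \<nu> {z. norm z > 1 / (2 * norm n)} < \<infinity>"
  using n by (intro emeasure_away_finite) simp

lemma radon_measure_slice:
  assumes "radon_measure \<nu>"
  shows "radon_measure (slice a)"
  unfolding radon_measure_def
proof (intro conjI allI impI)
  show "sets (slice a) = sets (restrict_space borel (- {0}))"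
    by (simp add: slice_def sets_eq)
  fix K :: "'a set" assume K: "compact K \<and> K \<subseteq> - {0}"
  then have K_sets: "K \<in> sets \<nu>" by (intro borel_imp_sets borel_compact) auto
  then have "emeasure (slice a) K = emeasure \<nu> (slab (n \<bullet> a) \<inter> K)"
    by (simp add: slice_def emeasure_restricted slab_sets)
  also have "\<dots> \<le> emeasure \<nu> K" using K_sets by (intro emeasure_mono) auto
  also have "\<dots> < \<infinity>" using assms K by (simp add: radon_measure_def)
  finally show "emeasure (slice a) K < \<infinity>" .
qed

lemma reflected_slice: "reflected (slice a) (slice (- a))"
  unfolding reflected_def
  using emeasure_restricted_uminus[OF slab_sets] by (simp add: slice_def slab_uminus)

lemma supp_slice: "supp (slice a) \<subseteq> {z. n \<bullet> z = n \<bullet> a}"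
proof (rule ccontr)
  let ?H = "{z. n \<bullet> z = n \<bullet> a}"
  assume "\<not> supp (slice a) \<subseteq> ?H"
  then obtain z where z: "z \<in> supp (slice a)" "z \<in> - ?H" by auto
  have "open (- ?H)" by (simp add: open_Compl closed_hyperplane)
  then obtain r where r: "r > 0" "ball z r \<subseteq> - ?H" using z(2) by (rule openE)
  have "ball z r - {0} \<in> sets \<nu>" by (rule borel_imp_sets) auto
  moreover have "slab (n \<bullet> a) \<inter> (ball z r - {0}) = {}" using r(2) by (auto simp: slab_def)
  ultimately have "emeasure (slice a) (ball z r - {0}) = 0"
    by (simp add: slice_def emeasure_restricted slab_sets)
  then show False using z(1) r(1) by (auto simp: supp_def)
qed

lemma levy_measure_slice_0: "levy_measure (slice 0)"
  unfolding slice_def by (rule levy_measure_restricted[OF slab_sets]) (simp add: slab_uminus)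

lemma levy_measure_jumps: "levy_measure (density \<nu> (indicator (\<Union>k. jumps k)))"
  by (rule levy_measure_restricted[OF _ Union_jumps_uminus]) (intro sets.countable_UN'' jumps_sets, auto)

lemma lattice_bij: "bij_betw (\<lambda>k. of_int k *\<^sub>R generator) (UNIV - {0}) (lattice - {0})"
proof -
  have "generator \<noteq> 0" using inner_generator by auto
  then show ?thesis
    by (auto simp: bij_betw_def inj_on_def lattice_def)
qed

lemma slice_total_mass: "emeasure (slice a) (space (slice a)) = emeasure \<nu> (slab (n \<bullet> a))"
  using sets.sets_into_space[OF slab_sets]
  by (simp add: slice_def emeasure_restricted slab_sets Int_absorb2)

text \<open>The slabs at nonzero levels are disjoint and lie in one region away from the origin,
  whose finite mass bounds every partial sum.\<close>

lemma total_mass_finite: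
  "levy_mass (slice 0) + (\<Sum>\<^sub>\<infinity>a\<in>lattice - {0}. emeasure (slice a) (space (slice a))) < \<infinity>"
proof -
  let ?E = "{z. norm z > 1 / (2 * norm n)}"
  have E_sets: "?E \<in> sets \<nu>" by (rule borel_imp_sets) auto
  have "(\<Sum>\<^sub>\<infinity>a\<in>lattice - {0}. emeasure (slice a) (space (slice a))) =
      (\<Sum>\<^sub>\<infinity>k\<in>UNIV - {0}. emeasure \<nu> (jumps k))"
  proof -
    have "emeasure \<nu> (slab (n \<bullet> (of_int k *\<^sub>R generator))) = emeasure \<nu> (jumps k)" if "k \<in> UNIV - {0}" for k
      using that by (simp add: jumps_def inner_generator)
    then show ?thesis
      unfolding slice_total_mass infsum_reindex_bij_betw[OF lattice_bij, symmetric] by (rule infsum_cong)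
  qed
  also have "\<dots> = (SUP F\<in>{F. finite F \<and> F \<subseteq> UNIV - {0}}. \<Sum>k\<in>F. emeasure \<nu> (jumps k))"
    by (rule nonneg_infsum_complete) simp
  also have "\<dots> \<le> emeasure \<nu> ?E"
  proof (rule SUP_least)
    fix F :: "int set" assume "F \<in> {F. finite F \<and> F \<subseteq> UNIV - {0}}"
    then have "(\<Sum>k\<in>F. emeasure \<nu> (jumps k)) = emeasure \<nu> (\<Union>k\<in>F. jumps k)"
      using jumps_sets jumps_disjoint
      by (intro sum_emeasure) (auto simp: disjoint_family_on_def)
    also have "\<dots> \<le> emeasure \<nu> ?E"
      using jumps_away by (intro emeasure_mono E_sets) blast
    finally show "(\<Sum>k\<in>F. emeasure \<nu> (jumps k)) \<le> emeasure \<nu> ?E" .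
  qed
  also have "\<dots> < \<infinity>" by (rule emeasure_jumps_finite)
  finally have "(\<Sum>\<^sub>\<infinity>a\<in>lattice - {0}. emeasure (slice a) (space (slice a))) < \<infinity>" .
  then show ?thesis
    using levy_measure.levy_mass[OF levy_measure_slice_0] by simp
qed

section \<open>The series of jumps as one integral\<close>

definition increment :: "('a \<Rightarrow> real) \<Rightarrow> int \<Rightarrow> 'a \<Rightarrow> real" where
  "increment u k x = (\<integral>z. indicator (jumps k) z * (u (x + z) - u x) \<partial>\<nu>)"

lemma jump_sum_eq:
  assumes "L_infty u"
  shows "jump_sum kernel lattice slice u x = (\<Sum>\<^sub>\<infinity>k. increment u k x)"
proof -
  note [measurable] = L_infty_measurable[OF assms]
  let ?J = "\<lambda>a. LINT z:{v + a |v. v \<in> kernel}|slice a. u (x + z) - u x"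
  have eq: "?J (of_int k *\<^sub>R generator) = increment u k x" if "k \<noteq> 0" for k
  proof -
    have meas: "(\<lambda>z. indicator {z. n \<bullet> z = of_int k} z * (u (x + z) - u x)) \<in> borel_measurable \<nu>"
      by (rule measurable_from_borel) measurable
    have "?J (of_int k *\<^sub>R generator) =
        (\<integral>z. indicator {z. n \<bullet> z = of_int k} z * (u (x + z) - u x) \<partial>density \<nu> (indicator (slab (of_int k))))"
      unfolding kernel_translate by (simp add: set_lebesgue_integral_def slice_def inner_generator)
    also have "\<dots> = (\<integral>z. indicator (slab (of_int k)) z * (indicator {z. n \<bullet> z = of_int k} z * (u (x + z) - u x)) \<partial>\<nu>)"
      by (rule integral_restricted[OF slab_sets meas])
    also have "\<dots> = increment u k x"
      unfolding increment_def using that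
      by (intro Bochner_Integration.integral_cong) (auto simp: jumps_def slab_def indicator_def)
    finally show ?thesis .
  qed
  have "jump_sum kernel lattice slice u x = (\<Sum>\<^sub>\<infinity>k\<in>UNIV - {0}. ?J (of_int k *\<^sub>R generator))"
    unfolding jump_sum_def by (rule infsum_reindex_bij_betw[OF lattice_bij, symmetric])
  also have "\<dots> = (\<Sum>\<^sub>\<infinity>k. increment u k x)"
    by (rule infsum_cong_neutral) (auto simp: eq increment_def jumps_def)
  finally show ?thesis .
qed

text \<open>The series agrees with an integral over all jumps only almost everywhere, and comparing
  their integrals then requires measurability.\<close>

lemma jump_sum_measurable:
  assumes "L_infty u"
  shows "jump_sum kernel lattice slice u \<in> borel_measurable borel"
proof -
  note [measurable] = L_infty_measurable[OF assms]
  interpret sigma_finite_measure \<nu> by (rule sigma_finite)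
  have "increment u k \<in> borel_measurable lborel" for k
    unfolding increment_def[abs_def]
  proof (rule borel_measurable_lebesgue_integral)
    have [measurable]: "jumps k \<in> sets borel" by (rule sets_imp_borel[OF jumps_sets])
    show "(\<lambda>(x, z). indicator (jumps k) z * (u (x + z) - u x)) \<in> borel_measurable (lborel \<Otimes>\<^sub>M \<nu>)"
      by (rule measurable_pair_from_borel) measurable
  qed
  from borel_measurable_infsum_int[of "increment u", OF this]
  show ?thesis by (simp add: jump_sum_eq[OF assms, abs_def])
qed

lemma integral_jump_sum_eq:
  assumes u: "L_infty u" and \<psi>: "test_function \<psi>"
  shows "(LINT x|lborel. jump_sum kernel lattice slice u x * \<psi> x) =
    (\<integral>z. \<integral>x. u x * second_diff \<psi> z x \<partial>lborel \<partial>density \<nu> (indicator (\<Union>k. jumps k))) / 2"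
proof -
  note [measurable] = L_infty_measurable[OF u] test_function_measurable[OF \<psi>] jump_sum_measurable[OF u]
  let ?J = "\<Union>k. jumps k"
  have J_sets: "?J \<in> sets \<nu>" by (intro sets.countable_UN'' jumps_sets) auto
  let ?\<nu>1 = "density \<nu> (indicator ?J)"
  interpret L1: levy_measure ?\<nu>1 by (rule levy_measure_jumps)
  interpret P: pair_sigma_finite lborel ?\<nu>1 by (rule L1.pair_sigma_finite)
  have "emeasure ?\<nu>1 (space ?\<nu>1) = emeasure \<nu> ?J"
    using sets.sets_into_space[OF J_sets] by (simp add: emeasure_restricted J_sets Int_absorb2)
  also have "\<dots> \<le> emeasure \<nu> {z. norm z > 1 / (2 * norm n)}"
    using jumps_away by (intro emeasure_mono borel_imp_sets) auto
  also have "\<dots> < \<infinity>" by (rule emeasure_jumps_finite)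
  finally have fin: "emeasure ?\<nu>1 (space ?\<nu>1) < \<infinity>" .
  note int = L1.integrable_pair_jump[OF fin u \<psi>]
  \<comment> \<open>Fubini gives integrability in \<open>z\<close> of the product with
    \<open>\<psi> x\<close> for almost every \<open>x\<close>. Where
    \<open>\<psi> x \<noteq> 0\<close> the factor can be cancelled; elsewhere both sides are 0
    whatever the series does.\<close>
  have "AE x in lborel. jump_sum kernel lattice slice u x * \<psi> x = (\<integral>z. (u (x + z) - u x) * \<psi> x \<partial>?\<nu>1)"
    using P.AE_integrable_fst[OF int]
  proof eventually_elim
    case (elim x)
    show ?case
    proof (cases "\<psi> x = 0")
      case False
      let ?g = "\<lambda>z. u (x + z) - u x"
      have g_meas: "?g \<in> borel_measurable \<nu>"
        by (rule measurable_from_borel) measurable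
      have "integrable ?\<nu>1 ?g" using elim False by simp
      then have Jg: "integrable \<nu> (\<lambda>z. indicator ?J z * ?g z)"
        by (subst (asm) integrable_restricted[OF J_sets g_meas])
      \<comment> \<open>The increment is cut off to \<open>?J\<close> before the partition is
        applied, since near the origin it need not be integrable; on each \<open>jumps k\<close> the
        cut-off changes nothing.\<close>
      have ind: "indicator (jumps k) z * (indicator ?J z * ?g z) = indicator (jumps k) z * ?g z"
        "indicator ?J z * (indicator ?J z * ?g z) = indicator ?J z * ?g z" for k z
        by (auto simp: indicator_def)
      have "((\<lambda>k. \<integral>z. indicator (jumps k) z * (indicator ?J z * ?g z) \<partial>\<nu>) has_sum
          (\<integral>z. indicator ?J z * (indicator ?J z * ?g z) \<partial>\<nu>)) UNIV"
        by (rule has_sum_integral_partition[OF jumps_sets jumps_disjoint Jg])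
      then have "((\<lambda>k. increment u k x) has_sum (\<integral>z. indicator ?J z * ?g z \<partial>\<nu>)) UNIV"
        by (simp only: ind increment_def)
      then have "jump_sum kernel lattice slice u x = (\<integral>z. ?g z \<partial>?\<nu>1)"
        unfolding jump_sum_eq[OF u] integral_restricted[OF J_sets g_meas] by (rule infsumI)
      then show ?thesis by simp
    qed simp
  qed
  then have "(LINT x|lborel. jump_sum kernel lattice slice u x * \<psi> x) =
      (\<integral>x. \<integral>z. (u (x + z) - u x) * \<psi> x \<partial>?\<nu>1 \<partial>lborel)"
    using borel_measurable_integrable[OF P.integrable_fst[OF int]]
    by (intro integral_cong_AE) auto
  also have "\<dots> = (\<integral>z. \<integral>x. u x * second_diff \<psi> z x \<partial>lborel \<partial>?\<nu>1) / 2"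
    by (rule L1.integral_jump_eq[OF fin u \<psi>])
  finally show ?thesis .
qed

text \<open>The splitting takes place after both integrations have been exchanged, on the absolutely
  integrable function \<open>G\<close> of the jump, so that no principal value has to be
  split.\<close>

lemma has_form_slices: "has_form \<nu> kernel lattice slice"
  unfolding has_form_def
proof (intro allI impI)
  fix u \<psi> :: "'a \<Rightarrow> real" assume "L_infty u \<and> test_function \<psi>"
  then have u: "L_infty u" and \<psi>: "test_function \<psi>" by auto
  interpret L0: levy_measure "slice 0" by (rule levy_measure_slice_0)
  let ?J = "\<Union>k. jumps k"
  have J_sets: "?J \<in> sets \<nu>" by (intro sets.countable_UN'' jumps_sets) auto
  define G where "G z = (\<integral>x. u x * second_diff \<psi> z x \<partial>lborel)" for z
  have G: "integrable \<nu> G"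
    unfolding G_def[abs_def] by (rule integrable_inner_second_diff[OF u \<psi>])
  have G_meas: "G \<in> borel_measurable \<nu>" using G by (rule borel_measurable_integrable)
  have int0: "integrable \<nu> (\<lambda>z. indicator (slab 0) z * G z)"
    using integrable_mult_indicator[OF slab_sets G] by simp
  have int1: "integrable \<nu> (\<lambda>z. indicator ?J z * G z)"
    using integrable_mult_indicator[OF J_sets G] by simp
  have "(\<integral>z. G z \<partial>\<nu>) = (\<integral>z. indicator (slab 0) z * G z + indicator ?J z * G z \<partial>\<nu>)"
  proof (rule integral_cong_AE)
    \<comment> \<open>Almost every jump has an integral level, so the slab at level 0 and the union
      of the others carry the whole measure.\<close>
    show "AE z in \<nu>. G z = indicator (slab 0) z * G z + indicator ?J z * G z"
      using integral AE_space
    proof eventually_elim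
      case (elim z)
      have "z \<noteq> 0" using elim(2) by (simp add: space_eq)
      obtain k where k: "n \<bullet> z = of_int k" using elim(1) by (rule Ints_cases)
      show ?case
      proof (cases "k = 0")
        case True
        then have "z \<in> slab 0" "z \<notin> ?J"
          using k \<open>z \<noteq> 0\<close> by (auto simp: slab_def jumps_def)
        then show ?thesis by simp
      next
        case False
        then have "z \<notin> slab 0" "z \<in> jumps k"
          using k \<open>z \<noteq> 0\<close> by (auto simp: slab_def jumps_def)
        then have "z \<notin> slab 0" "z \<in> ?J" by auto
        then show ?thesis by simp
      qed
    qed
  qed (use G_meas int0 int1 in \<open>auto intro: borel_measurable_add borel_measurable_integrable\<close>)
  also have "\<dots> = (\<integral>z. indicator (slab 0) z * G z \<partial>\<nu>) + (\<integral>z. indicator ?J z * G z \<partial>\<nu>)"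
    by (rule Bochner_Integration.integral_add[OF int0 int1])
  also have "(\<integral>z. indicator (slab 0) z * G z \<partial>\<nu>) = (\<integral>z. G z \<partial>slice 0)"
    unfolding slice_def inner_zero_right by (rule integral_restricted[OF slab_sets G_meas, symmetric])
  also have "(\<integral>z. indicator ?J z * G z \<partial>\<nu>) = (\<integral>z. G z \<partial>density \<nu> (indicator ?J))"
    by (rule integral_restricted[OF J_sets G_meas, symmetric])
  finally show "levy_dist \<nu> u \<psi> = levy_dist (slice 0) u \<psi> +
      (LINT x|lborel. jump_sum kernel lattice slice u x * \<psi> x)"
    unfolding levy_dist_eq[OF u \<psi>] L0.levy_dist_eq[OF u \<psi>] integral_jump_sum_eq[OF u \<psi>]
    by (simp add: G_def add_divide_distrib)
qed

end

section \<open>Cosine solutions and the equivalence\<close>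

lemma nonconstant_cos:
  fixes n :: "'a::euclidean_space"
  assumes "n \<noteq> 0"
  shows "nonconstant (\<lambda>x. cos (2 * pi * (n \<bullet> x)))"
  unfolding nonconstant_def
proof
  let ?u = "\<lambda>x. cos (2 * pi * (n \<bullet> x))"
  assume "\<exists>c. AE x in lborel. ?u x = c"
  then obtain c where c: "AE x in lborel. ?u x = c" by blast
  \<comment> \<open>By continuity the exceptional set is open, and a nonempty open set is not
    negligible.\<close>
  have "?u x = c" for x
  proof (rule ccontr)
    assume "?u x \<noteq> c"
    have "closed {x. ?u x = c}" by (intro closed_Collect_eq continuous_intros)
    then have op: "open {x. ?u x \<noteq> c}" by (simp add: Collect_neg_eq open_Compl)
    have "emeasure lborel {x. ?u x \<noteq> c} = 0"
      using c op by (subst (asm) AE_iff_measurable[OF _ refl]) auto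
    then have "{x. ?u x \<noteq> c} \<in> null_sets lborel"
      using op by (auto simp: null_sets_def)
    then have "negligible {x. ?u x \<noteq> c}"
      by (simp add: negligible_iff_null_sets null_sets_completionI)
    then show False using open_not_negligible[OF op] \<open>?u x \<noteq> c\<close> by blast
  qed
  \<comment> \<open>At the second point \<open>n \<bullet> x = 1 / 2\<close>, so the cosine is -1
    there and 1 at the origin.\<close>
  from this[of 0] this[of "(1 / (2 * (n \<bullet> n))) *\<^sub>R n"] show False
    using assms by simp
qed

theorem theorem4p17:
  fixes \<mu> :: "(real ^ 'n) measure"
  assumes "radon_measure \<mu>" and "reflected \<mu> \<mu>" and "levy_mass \<mu> < \<infinity>"
  shows "(\<exists>u. L_infty u \<and> nonconstant u \<and> (\<forall>\<psi>. test_function \<psi> \<longrightarrow> levy_dist \<mu> u \<psi> = 0)) \<longleftrightarrow>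
    (\<exists>(V :: (real ^ 'n) set) \<Lambda> M.
       subspace V \<and> relative_lattice \<Lambda> \<and> (\<forall>a\<in>\<Lambda>. radon_measure (M a)) \<and>
       has_form \<mu> V \<Lambda> M \<and>
       V \<noteq> UNIV \<and> V \<inter> span \<Lambda> = {0} \<and>
       (\<forall>a\<in>\<Lambda>. reflected (M a) (M (- a))) \<and>
       (\<forall>a\<in>\<Lambda>. supp (M a) \<subseteq> {v + a | v. v \<in> V}) \<and>
       levy_mass (M 0) + (\<Sum>\<^sub>\<infinity>a\<in>\<Lambda> - {0}. emeasure (M a) (space (M a))) < \<infinity>)"
    (is "?solution \<longleftrightarrow> ?form")
proof
  assume ?solution
  then obtain u where "L_infty u \<and> nonconstant u \<and> (\<forall>\<psi>. test_function \<psi> \<longrightarrow> levy_dist \<mu> u \<psi> = 0)"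
    by (rule exE)
  then have u: "L_infty u" "nonconstant u" and "\<forall>\<psi>. test_function \<psi> \<longrightarrow> levy_dist \<mu> u \<psi> = 0"
    by simp_all
  then have sol: "levy_dist \<mu> u \<psi> = 0" if "test_function \<psi>" for \<psi>
    using that by simp
  interpret levy_measure \<mu>
    using assms by unfold_locales (auto simp: radon_measure_def)
  from integral_functional_of_solution[OF u sol] obtain n where
    n: "n \<noteq> 0 \<and> (AE z in \<mu>. n \<bullet> z \<in> \<int>)" by (rule exE)
  interpret levy_measure_integral \<mu> n
    using n by unfold_locales auto
  have "supp (slice a) \<subseteq> {v + a |v. v \<in> kernel}" for a
    unfolding kernel_translate by (rule supp_slice)
  then show ?form
    by (intro exI[of _ kernel] exI[of _ lattice] exI[of _ slice] conjI ballI subspace_kernel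
        relative_lattice_lattice radon_measure_slice[OF assms(1)] has_form_slices kernel_neq_UNIV
        kernel_Int_span reflected_slice total_mass_finite)
next
  assume ?form
  then show ?solution
  proof (elim exE conjE)
    fix V \<Lambda> :: "(real ^ 'n) set" and M
    assume V: "subspace V" "V \<noteq> UNIV"
      and \<Lambda>: "relative_lattice \<Lambda>" "V \<inter> span \<Lambda> = {0}"
      and radon: "\<forall>a\<in>\<Lambda>. radon_measure (M a)"
      and refl: "\<forall>a\<in>\<Lambda>. reflected (M a) (M (- a))"
      and supp: "\<forall>a\<in>\<Lambda>. supp (M a) \<subseteq> {v + a | v. v \<in> V}"
      and mass: "levy_mass (M 0) + (\<Sum>\<^sub>\<infinity>a\<in>\<Lambda> - {0}. emeasure (M a) (space (M a))) < \<infinity>"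
      and form: "has_form \<mu> V \<Lambda> M"
    obtain B where B: "finite B" "independent B"
        "\<Lambda> = {\<Sum>b\<in>B. of_int (c b) *\<^sub>R b | c :: real ^ 'n \<Rightarrow> int. True}"
      using \<Lambda>(1) unfolding relative_lattice_def by (elim exE conjE)
    have "B \<subseteq> \<Lambda>"
    proof
      fix w assume "w \<in> B"
      then have "w = (\<Sum>b\<in>B. of_int (if b = w then 1 else 0) *\<^sub>R b)"
        using B(1) by (simp add: if_distrib[of "\<lambda>i. of_int i *\<^sub>R _"] sum.delta cong: if_cong)
      then show "w \<in> \<Lambda>"
        unfolding B(3) by (intro CollectI exI[of _ "\<lambda>b. if b = w then 1 else 0"] conjI TrueI)
    qed
    then have "span B \<subseteq> span \<Lambda>" by (rule span_mono)
    then have "V \<inter> span B = {0}" using \<Lambda>(2) subspace_0[OF V(1)] span_zero by blast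
    from exists_integral_functional[OF V B(2) this]
    obtain n where "n \<noteq> 0 \<and> (\<forall>v\<in>V. n \<bullet> v = 0) \<and> (\<forall>b\<in>B. n \<bullet> b \<in> \<int>)" by (rule exE)
    then have n: "n \<noteq> 0" "\<And>v. v \<in> V \<Longrightarrow> n \<bullet> v = 0" "\<And>b. b \<in> B \<Longrightarrow> n \<bullet> b \<in> \<int>" by simp_all
    have n_int: "n \<bullet> a \<in> \<int>" if a: "a \<in> \<Lambda>" for a
    proof -
      obtain c :: "real ^ 'n \<Rightarrow> int" where "a = (\<Sum>b\<in>B. of_int (c b) *\<^sub>R b)"
        using a unfolding B(3) by (elim CollectE exE conjE)
      then show ?thesis
        using n(3) by (auto simp: inner_sum_right intro!: Ints_sum Ints_mult)
    qed
    \<comment> \<open>Every vector with an integral value of \<open>n\<close> is a period; this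
      covers \<open>V\<close>, where \<open>n\<close> vanishes, and every translate
      \<open>V + a\<close>, where it equals \<open>n \<bullet> a\<close>.\<close>
    define u where "u x = cos (2 * pi * (n \<bullet> x))" for x
    have periodic: "u (x + z) = u x" if "n \<bullet> z \<in> \<int>" for x z
      using cos_integer_2pi[OF that] sin_integer_2pi[OF that]
      by (simp add: u_def inner_add_right distrib_left cos_add)
    have u: "L_infty u"
      unfolding L_infty_def
    proof
      show "u \<in> borel_measurable borel" unfolding u_def[abs_def] by measurable
      show "\<exists>C. AE x in lborel. \<bar>u x\<bar> \<le> C" by (intro exI[of _ 1] AE_I2) (simp add: u_def)
    qed
    have "0 \<in> \<Lambda>" unfolding B(3) by (auto intro!: exI[of _ "\<lambda>_. 0"])
    interpret L0: levy_measure "M 0"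
    proof
      show "sets (M 0) = sets (restrict_space borel (- {0}))"
        using radon \<open>0 \<in> \<Lambda>\<close> by (simp add: radon_measure_def)
      show "reflected (M 0) (M 0)" using bspec[OF refl \<open>0 \<in> \<Lambda>\<close>] by simp
      show "levy_mass (M 0) < \<infinity>" using mass by (simp add: less_top)
    qed
    have "supp (M 0) \<subseteq> V" using bspec[OF supp \<open>0 \<in> \<Lambda>\<close>] by simp
    \<comment> \<open>Subspaces are closed, so a support inside \<open>V\<close> means that
      \<open>M 0\<close> is carried by \<open>V\<close>.\<close>
    from L0.AE_in_closed[OF closed_subspace[OF V(1)] this]
    have per0: "AE z in M 0. \<forall>x. u (x + z) = u x"
      by eventually_elim (use n(2) periodic in simp)
    \<comment> \<open>Each integral extends over \<open>V + a\<close> only, where the increment of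
      \<open>u\<close> vanishes identically, so the sum is zero at every point and not merely almost
      everywhere.\<close>
    have jump0: "jump_sum V \<Lambda> M u x = 0" for x
      unfolding jump_sum_def
    proof (rule infsum_0)
      fix a assume "a \<in> \<Lambda> - {0}"
      then have "n \<bullet> z \<in> \<int>" if "z \<in> {v + a |v. v \<in> V}" for z
        using that n(2) n_int by (auto simp: inner_add_right)
      then have "indicator {v + a |v. v \<in> V} z *\<^sub>R (u (x + z) - u x) = 0" for z
        using periodic by (cases "z \<in> {v + a |v. v \<in> V}") (simp_all del: mem_Collect_eq)
      then show "(LINT z:{v + a |v. v \<in> V}|M a. u (x + z) - u x) = 0"
        by (simp only: set_lebesgue_integral_def integral_zero)
    qed
    have "levy_dist \<mu> u \<psi> = 0" if \<psi>: "test_function \<psi>" for \<psi>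
      using form u \<psi> L0.levy_dist_periodic_eq_0[OF u \<psi> per0] by (simp add: has_form_def jump0)
    moreover have "nonconstant u"
      using nonconstant_cos[OF n(1)] by (simp add: u_def[abs_def])
    ultimately show ?solution using u by blast
  qed
qed

end
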